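(* Let $n\ge 1$. If $\pi\in S_n$ is a permutation with exactly $k$ descents, then the number of permutations $\sigma\in S_n$ such that $s(\sigma)=\pi$ is given by \[\sum_{\mathscr H\in\mathcal H_{\{0,2\}}(\pi)}\ \prod_{t=0}^kC_{\widehat q_t(\mathscr H)},\] where $s$ is the deterministic stack-sorting map and $C_i$ is the $i$-th Catalan number.
   Context: Notation: $[m]=\{1,\ldots,m\}$; permutations in $S_n$ are written as words $\pi_1\cdots\pi_n$. A descent of $\pi$ is an index $i\in[n-1]$ with $\pi_i>\pi_{i+1}$. Stack-sorting map. Given an input permutation $\sigma=\sigma_1\cdots\sigma_n$, $s(\sigma)$ is computed using a vertical stack (initially empty): at any time, if the leftmost remaining entry of the input is smaller than the entry at the top of the stack, or if the stack is empty, that leftmost entry is placed on top of the stack; otherwise the entry at the top of the stack is removed and annexed to the right end of the growing output. (Once the input is exhausted, the stack is emptied into the output from the top.) The final output is $s(\sigma)$. For example, $s(35214)=31245$. Valid hook configurations. The diagram of $\pi$ consists of the points $(i,\pi_i)$, $i\in[n]$. A hook $H$ is determined by indices $i<j$ with $\pi_i<\pi_j$: it is the union of the vertical segment from $(i,\pi_i)$ to $(i,\pi_j)$ and the horizontal segment from $(i,\pi_j)$ to $(j,\pi_j)$. Its southwest endpoint is ${}_eH=(i,\pi_i)$ and its northeast endpoint is $H^e=(j,\pi_j)$. A valid hook configuration of $\pi$ is an $m$-tuple $\mathscr H=(H_1,\ldots,H_m)$ ($m\ge 0$) of hooks in the diagram of $\pi$ such that: (a) if ${}_eH_\ell=(i_\ell,\pi_{i_\ell})$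 for each $\ell\in[m]$, then $i_1<i_2<\cdots<i_m$; (b) if $i$ is a descent of $\pi$, then $(i,\pi_i)={}_eH_\ell$ for some $\ell\in[m]$; (c) if $(j,\pi_j)=H_\ell^e$ for some $\ell\in[m]$, then there exist $\ell',\ell''\in[m]$ such that the $x$-coordinate of ${}_eH_{\ell'}$ is a descent of $\pi$, $(j-1,\pi_{j-1})={}_eH_{\ell''}$, and $H_{\ell'}^e=H_{\ell''}^e=(j,\pi_j)$; (d) if $\ell,\ell'\in[m]$, ${}_eH_\ell=(i,\pi_i)$, $H_\ell^e=(j,\pi_j)$, ${}_eH_{\ell'}=(i',\pi_{i'})$, $H_{\ell'}^e=(j',\pi_{j'})$, $\pi_j<\pi_{j'}$, and the real intervals $[i,j]$ and $[i',j']$ have more than one point in common, then $[i,j]\subseteq[i',j']$. The identity permutation has exactly one valid hook configuration, the empty one. Write $\mathcal H(\pi)$ for the set of valid hook configurations of $\pi$, $|\mathscr H|=m$ for the number of hooks, and $NE(\mathscr H)=\{H_1^e,\ldots,H_m^e\}$. For $j\in[n]$, $w_j(\mathscr H)$ is the number of hooks in $\mathscr H$ with northeast endpoint $(j,\pi_j)$. $\mathcal H_{\{0,2\}}(\pi)=\{\mathscr H\in\mathcal H(\pi): w_j(\mathscr H)\in\{0,2\}\text{ for all }j\in[n]\}$. Coloring. Given $\mathscr H=(H_1,\ldots,H_m)\in\mathcal H(\pi)$, color the points of the diagram with colors $c_0,\ldots,c_m$. The hook $H_\ell$ has color $c_\ell$; if ${}_eH_\ell=(i,\pi_i)$ and $H_\ell^e=(j,\pi_j)$,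 its top part is the segment from $(i+1/2,\pi_j)$ to $(j,\pi_j)$. If $(k,\pi_k)\in NE(\mathscr H)$, give $(k,\pi_k)$ the color $c_r$ where $r$ is the largest index with $H_r^e=(k,\pi_k)$. Otherwise move directly upward from $(k,\pi_k)$ until first hitting the top part of a hook, and give $(k,\pi_k)$ the color of that hook; if several hooks are hit simultaneously, use the one whose southwest endpoint is farthest to the right; if no top part is hit, use $c_0$. Let $q_t(\mathscr H)$ be the number of points $(\ell,\pi_\ell)$ of color $c_t$. Reduced color counts. Let $\Theta(\mathscr H)$ be the set of $i\in\{0,1,\ldots,|\mathscr H|\}$ such that $c_i$ is not the color of any point in $NE(\mathscr H)$, and $\widehat{|\mathscr H|}=|\Theta(\mathscr H)|-1=|\mathscr H|-|NE(\mathscr H)|$. Writing $\Theta(\mathscr H)=\{i_0<i_1<\cdots<i_{\widehat{|\mathscr H|}}\}$, set $\widehat q_t(\mathscr H)=q_{i_t}(\mathscr H)$. For $\mathscr H\in\mathcal H_{\{0,2\}}(\pi)$ with $\pi$ having $k$ descents, $\widehat{|\mathscr H|}=k$. *)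

theory Defs
  imports Complex_Main "HOL-Combinatorics.Multiset_Permutations"
begin

text \<open>
  A permutation in \<open>S\<^sub>n\<close> is its word, an element of \<^term>\<open>permutations_of_set {1..n}\<close>.
  Positions are 1-based, as are the hook indices \<open>1..m\<close> below; a word index \<open>i\<close> also stands for the
  point \<open>(i, entry \<pi> i)\<close> of the diagram.
\<close>

definition entry :: "nat list \<Rightarrow> nat \<Rightarrow> nat" where
  "entry \<pi> i = \<pi> ! (i - 1)"

definition descents :: "nat list \<Rightarrow> nat set" where
  "descents \<pi> = {i. 1 \<le> i \<and> i + 1 \<le> length \<pi> \<and> entry \<pi> i > entry \<pi> (i + 1)}"

definition catalan :: "nat \<Rightarrow> nat" where
  "catalan n = ((2 * n) choose n) div (n + 1)"

text \<open>The arguments are the remaining input, the stack (top first) and the output so far.\<close>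

fun stack_run :: "nat list \<Rightarrow> nat list \<Rightarrow> nat list \<Rightarrow> nat list" where
  "stack_run [] [] out = out"
| "stack_run [] (y # stack) out = stack_run [] stack (out @ [y])"
| "stack_run (x # input) [] out = stack_run input [x] out"
| "stack_run (x # input) (y # stack) out =
     (if x < y then stack_run input (x # y # stack) out
      else stack_run (x # input) stack (out @ [y]))"

definition stack_sort :: "nat list \<Rightarrow> nat list" where
  "stack_sort \<sigma> = stack_run \<sigma> [] []"

lemma "stack_sort [3, 5, 2, 1, 4] = [3, 1, 2, 4, 5]"
  by (simp add: stack_sort_def)

text \<open>A hook is the pair of \<open>x\<close>-coordinates of its southwest and northeast endpoints.\<close>

type_synonym hook = "nat \<times> nat"

definition is_hook :: "nat list \<Rightarrow> hook \<Rightarrow> bool" where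
  "is_hook \<pi> h \<longleftrightarrow>
     1 \<le> fst h \<and> fst h < snd h \<and> snd h \<le> length \<pi> \<and> entry \<pi> (fst h) < entry \<pi> (snd h)"

definition sw :: "hook list \<Rightarrow> nat \<Rightarrow> nat" where
  "sw hs l = fst (hs ! (l - 1))"

definition ne :: "hook list \<Rightarrow> nat \<Rightarrow> nat" where
  "ne hs l = snd (hs ! (l - 1))"

text \<open>The last four conjuncts are the conditions (a) to (d), with real intervals in (d).\<close>

definition valid_hook_config :: "nat list \<Rightarrow> hook list \<Rightarrow> bool" where
  "valid_hook_config \<pi> hs \<longleftrightarrow>
     (\<forall>h\<in>set hs. is_hook \<pi> h) \<and>
     (\<forall>l\<in>{1..length hs}. \<forall>l'\<in>{1..length hs}. l < l' \<longrightarrow> sw hs l < sw hs l') \<and>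
     (\<forall>i\<in>descents \<pi>. \<exists>l\<in>{1..length hs}. sw hs l = i) \<and>
     (\<forall>l\<in>{1..length hs}. \<exists>l'\<in>{1..length hs}. \<exists>l''\<in>{1..length hs}.
        sw hs l' \<in> descents \<pi> \<and> sw hs l'' = ne hs l - 1 \<and>
        ne hs l' = ne hs l \<and> ne hs l'' = ne hs l) \<and>
     (\<forall>l\<in>{1..length hs}. \<forall>l'\<in>{1..length hs}.
        entry \<pi> (ne hs l) < entry \<pi> (ne hs l') \<longrightarrow>
        (\<exists>x y. x \<noteq> y \<and>
           {x, y} \<subseteq> {real (sw hs l)..real (ne hs l)} \<inter> {real (sw hs l')..real (ne hs l')}) \<longrightarrow>
        {real (sw hs l)..real (ne hs l)} \<subseteq> {real (sw hs l')..real (ne hs l')})"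

definition VHC :: "nat list \<Rightarrow> hook list set" where
  "VHC \<pi> = {hs. valid_hook_config \<pi> hs}"

definition NE :: "hook list \<Rightarrow> nat set" where
  "NE hs = ne hs ` {1..length hs}"

definition w :: "hook list \<Rightarrow> nat \<Rightarrow> nat" where
  "w hs j = card {l \<in> {1..length hs}. ne hs l = j}"

definition VHC02 :: "nat list \<Rightarrow> hook list set" where
  "VHC02 \<pi> = {hs \<in> VHC \<pi>. \<forall>j\<in>{1..length \<pi>}. w hs j \<in> {0, 2}}"

text \<open>
  The hooks whose top part, from \<open>(i + 1/2, \<pi>\<^sub>j)\<close> to \<open>(j, \<pi>\<^sub>j)\<close>, lies above the point with
  \<open>x\<close>-coordinate \<open>k\<close>, and among them the ones that are hit first.
\<close>

definition hooks_above :: "nat list \<Rightarrow> hook list \<Rightarrow> nat \<Rightarrow> nat set" where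
  "hooks_above \<pi> hs k =
     {l \<in> {1..length hs}. real (sw hs l) + 1/2 \<le> real k \<and> k \<le> ne hs l \<and>
        entry \<pi> k < entry \<pi> (ne hs l)}"

definition hooks_hit :: "nat list \<Rightarrow> hook list \<Rightarrow> nat \<Rightarrow> nat set" where
  "hooks_hit \<pi> hs k =
     {l \<in> hooks_above \<pi> hs k. \<forall>l'\<in>hooks_above \<pi> hs k. entry \<pi> (ne hs l) \<le> entry \<pi> (ne hs l')}"

text \<open>The color \<open>c\<^sub>r\<close> is represented by its index \<open>r\<close>.\<close>

definition color :: "nat list \<Rightarrow> hook list \<Rightarrow> nat \<Rightarrow> nat" where
  "color \<pi> hs k =
     (if k \<in> NE hs then Max {r \<in> {1..length hs}. ne hs r = k}
      else if hooks_hit \<pi> hs k = {} then 0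
      else (ARG_MAX (sw hs) l. l \<in> hooks_hit \<pi> hs k))"

definition q :: "nat list \<Rightarrow> hook list \<Rightarrow> nat \<Rightarrow> nat" where
  "q \<pi> hs t = card {l \<in> {1..length \<pi>}. color \<pi> hs l = t}"

definition \<Theta> :: "nat list \<Rightarrow> hook list \<Rightarrow> nat set" where
  "\<Theta> \<pi> hs = {i \<in> {0..length hs}. \<forall>p\<in>NE hs. color \<pi> hs p \<noteq> i}"

text \<open>
  \<open>i\<^sub>t\<close> is the entry with 0-based position \<open>t\<close> in the increasing enumeration of \<open>\<Theta>\<close>; it is meaningful
  for \<open>t < card (\<Theta> \<pi> hs)\<close>, and \<open>card (\<Theta> \<pi> hs) = k + 1\<close> if \<open>hs \<in> VHC02 \<pi>\<close> and \<open>\<pi>\<close> has \<open>k\<close> descents.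
\<close>

definition q_hat :: "nat list \<Rightarrow> hook list \<Rightarrow> nat \<Rightarrow> nat" where
  "q_hat \<pi> hs t = q \<pi> hs (sorted_list_of_set (\<Theta> \<pi> hs) ! t)"

text \<open>There are finitely many valid hook configurations, so sums over them are genuine sums.\<close>

lemma finite_VHC: "finite (VHC \<pi>)"
proof (rule finite_subset)
  let ?A = "{1..length \<pi>} \<times> {1..length \<pi>}"
  show "VHC \<pi> \<subseteq> {hs. set hs \<subseteq> ?A \<and> distinct hs}"
  proof
    fix hs assume "hs \<in> VHC \<pi>"
    then have hook: "\<forall>h\<in>set hs. is_hook \<pi> h"
      and inc: "\<And>l l'. \<lbrakk>l \<in> {1..length hs}; l' \<in> {1..length hs}; l < l'\<rbrakk> \<Longrightarrow> sw hs l < sw hs l'"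
      by (auto simp: VHC_def valid_hook_config_def)
    have "set hs \<subseteq> ?A"
      using hook by (force simp: is_hook_def)
    moreover have "fst (hs ! a) < fst (hs ! b)" if "a < b" "b < length hs" for a b
      using inc[of "Suc a" "Suc b"] that by (simp add: sw_def)
    then have "distinct hs"
      unfolding distinct_conv_nth by (metis linorder_neqE_nat less_irrefl)
    ultimately show "hs \<in> {hs. set hs \<subseteq> ?A \<and> distinct hs}" by simp
  qed
  show "finite {hs. set hs \<subseteq> ?A \<and> distinct hs}"
    by (rule finite_subset_distinct) simp
qed

end

theory Submission
  imports Defs "HOL-Computational_Algebra.Formal_Power_Series"
begin

text \<open>
  Let \<open>F(\<pi>)\<close> be the number of preimages of a word \<open>\<pi>\<close> with distinct letters. Since
  \<open>s(L m R) = s(L) s(R) m\<close> for the largest letter \<open>m\<close>, \<open>F(X m)\<close> is the sum of \<open>F(X\<^sub>1) F(X\<^sub>2)\<close> over all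
  splittings \<open>X = X\<^sub>1 X\<^sub>2\<close>. Hence increasing words are counted by Catalan numbers. Otherwise let \<open>M\<close> be
  the highest descent top; then \<open>\<pi> = A M B T\<close> where \<open>T = t\<^sub>1 \<dots> t\<^sub>l\<close> is increasing and consists of the letters
  above \<open>M\<close>, and induction on \<open>l\<close> gives
  \<open>F(A M B T) = \<Sum>\<^sub>r F(A M t\<^sub>r\<^sub>+\<^sub>1 \<dots> t\<^sub>l) F(B t\<^sub>1 \<dots> t\<^sub>r\<^sub>-\<^sub>1)\<close>.
  The sum over hook configurations obeys the same recursion: the hook \<open>K\<close> that starts at \<open>M\<close> ends at some
  \<open>t\<^sub>r\<close>, and every other hook lies either among the points sheltered by \<open>K\<close> (the second word) or among
  the unsheltered ones (the first word). The points colored by \<open>K\<close> are those that have the color \<open>c\<^sub>0\<close>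
  in the sheltered part.

  In a configuration with all \<open>w\<^sub>j\<close> in \<open>{0, 2}\<close>, exactly one of the two hooks ending at \<open>j\<close> starts at a
  descent and the other one is the hook from \<open>j - 1\<close>, so the latter carries no information; the only
  point that it colors is \<open>j\<close> itself.
\<close>

section \<open>Preimages under the stack-sorting map\<close>

lemma mset_stack_run: "mset (stack_run xs st out) = mset xs + mset st + mset out"
  by (induction xs st out rule: stack_run.induct) (auto simp: ac_simps)

lemma stack_run_empty_input: "stack_run [] st out = out @ st"
  by (induction st arbitrary: out) auto

lemma stack_run_append_output: "stack_run xs st (out @ out') = out @ stack_run xs st out'"
  by (induction xs st out' rule: stack_run.induct) auto

text \<open>The letters of \<open>st\<close> exceed everything that is read or lies above them, so
  none of them is popped while \<open>xs\<close> is read. Hence the emitted letters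
  \<open>out'\<close> and the block \<open>tp'\<close> left behind depend only on \<open>xs\<close>
  and \<open>tp\<close>.\<close>

lemma stack_run_append_input:
  "\<exists>out' tp'. (\<forall>rest st out. (\<forall>x y. x \<in> set xs \<union> set tp \<longrightarrow> y \<in> set st \<longrightarrow> x < y) \<longrightarrow>
       stack_run (xs @ rest) (tp @ st) out = stack_run rest (tp' @ st) (out @ out')) \<and>
    stack_run xs tp [] = out' @ tp'"
\<comment> \<open>The measure drops by one at a push, which moves a letter from the input to the
  stack, and by one at a pop.\<close>
proof (induction "length xs * 2 + length tp" arbitrary: xs tp rule: less_induct)
  case less
  show ?case
  proof (cases xs)
    case Nil
    then show ?thesis by (intro exI[of _ "[]"] exI[of _ tp]) (simp add: stack_run_empty_input)
  next
    case (Cons a as)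
    show ?thesis
    proof (cases "tp = [] \<or> a < hd tp")
      case True
      obtain out' tp' where
        1: "\<And>rest st out. (\<forall>x y. x \<in> set as \<union> set (a # tp) \<longrightarrow> y \<in> set st \<longrightarrow> x < y) \<Longrightarrow>
           stack_run (as @ rest) ((a # tp) @ st) out = stack_run rest (tp' @ st) (out @ out')" and
        2: "stack_run as (a # tp) [] = out' @ tp'"
        using less[of as "a # tp"] Cons by auto
      have step: "stack_run (a # as @ rest) (tp @ st) out = stack_run (as @ rest) (a # tp @ st) out"
        if "\<forall>y\<in>set st. a < y" for rest st out
        using that True by (cases tp; cases st) auto
      show ?thesis
        using 1 2 step[of _ "[]"] step[of "[]" "[]"]
        by (intro exI[of _ out'] exI[of _ tp']) (auto simp: Cons step)
    next
      case False
      then obtain t tp2 where tp: "tp = t # tp2" "\<not> a < t" by (cases tp) auto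
      obtain out' tp' where
        1: "\<And>rest st out. (\<forall>x y. x \<in> set xs \<union> set tp2 \<longrightarrow> y \<in> set st \<longrightarrow> x < y) \<Longrightarrow>
           stack_run (xs @ rest) (tp2 @ st) out = stack_run rest (tp' @ st) (out @ out')" and
        2: "stack_run xs tp2 [] = out' @ tp'"
        using less[of xs tp2] tp by auto
      show ?thesis
        using 1 2 stack_run_append_output[of xs tp2 "[t]" "[]"] tp Cons
        by (intro exI[of _ "t # out'"] exI[of _ tp']) auto
    qed
  qed
qed

text \<open>The arrival of \<open>m\<close> flushes everything left over from \<open>L\<close>.
  Afterwards \<open>m\<close> stays at the bottom of the stack, under all letters of
  \<open>R\<close>, and leaves last.\<close>

lemma stack_sort_decompose:
  assumes "\<And>x. x \<in> set L \<union> set R \<Longrightarrow> x < m"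
  shows "stack_sort (L @ m # R) = stack_sort L @ stack_sort R @ [m]"
proof -
  obtain out1 tp1 where
    L: "\<And>rest st out. (\<forall>x y. x \<in> set L \<union> set [] \<longrightarrow> y \<in> set st \<longrightarrow> x < y) \<Longrightarrow>
       stack_run (L @ rest) ([] @ st) out = stack_run rest (tp1 @ st) (out @ out1)"
    "stack_run L [] [] = out1 @ tp1"
    using stack_run_append_input[of L "[]"] by blast
  obtain out2 tp2 where
    R: "\<And>rest st out. (\<forall>x y. x \<in> set R \<union> set [] \<longrightarrow> y \<in> set st \<longrightarrow> x < y) \<Longrightarrow>
       stack_run (R @ rest) ([] @ st) out = stack_run rest (tp2 @ st) (out @ out2)"
    "stack_run R [] [] = out2 @ tp2"
    using stack_run_append_input[of R "[]"] by blast
  have pop: "stack_run (m # R) st out = stack_run R [m] (out @ st)" if "\<forall>x\<in>set st. x < m" for st out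
    using that by (induction st arbitrary: out) auto
  have "set tp1 \<subseteq> set L"
    using mset_eq_setD[OF mset_stack_run[of L "[]" "[]", simplified]] L(2) by auto
  then have "stack_run (L @ m # R) [] [] = stack_run R [m] (out1 @ tp1)"
    using L(1)[of "[]" "m # R" "[]"] pop[of tp1 out1] assms by auto
  also have "\<dots> = stack_run [] (tp2 @ [m]) ((out1 @ tp1) @ out2)"
    using R(1)[of "[m]" "[]" "out1 @ tp1"] assms by auto
  finally show ?thesis
    using L(2) R(2) by (simp add: stack_sort_def stack_run_empty_input)
qed

lemma mset_stack_sort: "mset (stack_sort \<sigma>) = mset \<sigma>"
  by (simp add: stack_sort_def mset_stack_run)

lemma stack_sort_Nil [simp]: "stack_sort [] = []"
  by (simp add: stack_sort_def)

section \<open>Fertility and splitting at the largest letter\<close>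

definition preimages :: "nat list \<Rightarrow> nat list set" where
  "preimages \<pi> = {\<sigma>. stack_sort \<sigma> = \<pi>}"

text \<open>Counting preimages of arbitrary words lets the recursion run on factors and subwords
  without renumbering their letters.\<close>

definition fertility :: "nat list \<Rightarrow> nat" where
  "fertility \<pi> = card (preimages \<pi>)"

lemma mset_preimages: "\<sigma> \<in> preimages \<pi> \<Longrightarrow> mset \<sigma> = mset \<pi>"
  using mset_stack_sort by (auto simp: preimages_def)

lemma finite_preimages: "finite (preimages \<pi>)"
  by (rule finite_subset[OF _ finite_lists_length_eq[of "set \<pi>" "length \<pi>"]])
     (auto dest!: mset_preimages intro: mset_eq_length dest: mset_eq_setD)

lemma fertility_Nil: "fertility [] = 1"
proof -
  have "preimages [] = {[]}"
    by (auto simp: preimages_def dest: mset_preimages[unfolded preimages_def, simplified])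
  then show ?thesis by (simp add: fertility_def)
qed

text \<open>Cutting \<open>\<sigma>\<close> at its largest letter and applying
  \<open>stack_sort_decompose\<close> shows that this letter ends the output.\<close>

lemma preimage_of_distinct_cases:
  assumes "\<sigma> \<in> preimages \<pi>" "distinct \<pi>" "\<pi> \<noteq> []"
  shows "\<exists>L R. \<sigma> = L @ last \<pi> # R \<and> (\<forall>x \<in> set L \<union> set R. x < last \<pi>) \<and>
    butlast \<pi> = stack_sort L @ stack_sort R"
proof -
  have ms: "mset \<sigma> = mset \<pi>" using mset_preimages[OF assms(1)] .
  have ne: "\<sigma> \<noteq> []" and dist: "distinct \<sigma>"
    using ms assms by (auto dest: mset_eq_imp_distinct_iff)
  define m where "m = Max (set \<sigma>)"
  have "m \<in> set \<sigma>" using ne by (simp add: m_def)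
  then obtain L R where LR: "\<sigma> = L @ m # R" by (meson split_list)
  have less: "x < m" if "x \<in> set L \<union> set R" for x
  proof -
    have "x \<in> set \<sigma>" using that LR by auto
    then have "x \<le> m" by (simp add: m_def)
    moreover have "x \<noteq> m" using that LR dist by auto
    ultimately show ?thesis by simp
  qed
  have "\<pi> = stack_sort L @ stack_sort R @ [m]"
    using assms(1) stack_sort_decompose[OF less] LR by (simp add: preimages_def)
  then have "last \<pi> = m" "butlast \<pi> = stack_sort L @ stack_sort R" by (auto simp: butlast_append)
  then show ?thesis using LR less by blast
qed

text \<open>By \<open>preimage_of_distinct_cases\<close> an output with distinct letters ends in its
  maximum. This removes most cuts in \<open>fertility_decomposition\<close>.\<close>

lemma fertility_eq_0:
  assumes "distinct \<pi>" "x \<in> set \<pi>" "last \<pi> < x"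
  shows "fertility \<pi> = 0"
proof -
  have False if \<sigma>: "\<sigma> \<in> preimages \<pi>" for \<sigma>
  proof -
    have "\<pi> \<noteq> []" using assms by auto
    then obtain L R where "\<sigma> = L @ last \<pi> # R" "\<forall>x \<in> set L \<union> set R. x < last \<pi>"
      using preimage_of_distinct_cases[OF \<sigma> assms(1)] by blast
    moreover have "x \<in> set \<sigma>" using mset_preimages[OF \<sigma>] assms mset_eq_setD by blast
    ultimately have "x \<in> set L \<union> set R \<or> x = last \<pi>" by auto
    then show False using assms(3) \<open>\<forall>x \<in> set L \<union> set R. x < last \<pi>\<close> by (metis less_asym less_irrefl)
  qed
  then have "preimages \<pi> = {}" by blast
  then show ?thesis by (simp add: fertility_def)
qed

text \<open>The largest letter cuts a preimage into \<open>L\<close> and \<open>R\<close>, and the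
  outputs of these two are the factors of \<open>X\<close>.\<close>

lemma fertility_snoc:
  assumes "distinct (X @ [m])" "\<And>x. x \<in> set X \<Longrightarrow> x < m"
  shows "fertility (X @ [m]) = (\<Sum>i\<le>length X. fertility (take i X) * fertility (drop i X))"
proof -
  \<comment> \<open>The index is the length of \<open>L\<close>, which is also the length of its
    output; it records where \<open>X\<close> is cut.\<close>
  define S where "S = (SIGMA i:{..length X}. preimages (take i X) \<times> preimages (drop i X))"
  define g where "g = (\<lambda>(i::nat, L, R). L @ m # R)"
  have sub: "set L \<union> set R \<subseteq> set X" "length L = i" if "(i, L, R) \<in> S" for i L R
  proof -
    have "mset L = mset (take i X)" "mset R = mset (drop i X)" "i \<le> length X"
      using that by (auto simp: S_def dest: mset_preimages)
    then show "set L \<union> set R \<subseteq> set X" "length L = i"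
      using set_take_subset[of i X] set_drop_subset[of i X]
      by (auto dest: mset_eq_setD) (metis length_take min.absorb2 mset_eq_length)
  qed
  have "bij_betw g S (preimages (X @ [m]))"
  proof (rule bij_betw_imageI)
    show "inj_on g S"
    proof (rule inj_onI)
      fix a a' assume "a \<in> S" "a' \<in> S" "g a = g a'"
      moreover obtain i L R i' L' R' where a: "a = (i, L, R)" "a' = (i', L', R')"
        by (metis prod_cases3)
      ultimately have *: "(i, L, R) \<in> S" "(i', L', R') \<in> S" "g (i, L, R) = g (i', L', R')"
        by auto
      have "m \<notin> set L" "m \<notin> set L'" "m \<notin> set R" "m \<notin> set R'" using sub(1)[OF *(1)] sub(1)[OF *(2)] assms(1) by auto
      then have "L = L'" "R = R'"
        using *(3) by (auto simp: g_def append_Cons_eq_iff)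
      then show "a = a'" unfolding a using sub(2)[OF *(1)] sub(2)[OF *(2)] by simp
    qed
    show "g ` S = preimages (X @ [m])"
    proof (intro subset_antisym subsetI)
      fix \<sigma> assume "\<sigma> \<in> g ` S"
      then obtain i L R where *: "(i, L, R) \<in> S" "\<sigma> = L @ m # R" by (auto simp: g_def)
      have "stack_sort \<sigma> = stack_sort L @ stack_sort R @ [m]"
        unfolding *(2) using sub(1)[OF *(1)] assms(2) by (intro stack_sort_decompose) auto
      then show "\<sigma> \<in> preimages (X @ [m])" using *(1) by (auto simp: S_def preimages_def)
    next
      fix \<sigma> assume "\<sigma> \<in> preimages (X @ [m])"
      from preimage_of_distinct_cases[OF this assms(1)]
      obtain L R where *: "\<sigma> = L @ m # R" "X = stack_sort L @ stack_sort R"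
        by auto
      have "(length (stack_sort L), L, R) \<in> S"
        by (auto simp: S_def * preimages_def)
      then show "\<sigma> \<in> g ` S" by (rule rev_image_eqI) (simp add: g_def *(1))
    qed
  qed
  then have "fertility (X @ [m]) = card S"
    by (simp add: fertility_def bij_betw_same_card)
  also have "\<dots> = (\<Sum>i\<le>length X. card (preimages (take i X) \<times> preimages (drop i X)))"
    unfolding S_def by (intro card_SigmaI) (auto simp: finite_preimages)
  finally show ?thesis by (simp only: fertility_def card_cartesian_product)
qed

section \<open>Catalan numbers\<close>

text \<open>The quotient is the difference of \<open>2 * n choose n\<close> and
  \<open>2 * n choose Suc n\<close>. Divisibility makes the truncating \<open>div\<close> in
  \<open>catalan\<close> exact.\<close>

lemma Suc_dvd_central_binomial: "Suc n dvd (2 * n) choose n"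
proof -
  have "Suc n * ((2 * n) choose Suc n) = (2 * n - n) * ((2 * n) choose n)"
    by (simp only: binomial_absorption binomial_absorb_comp)
  then have "Suc n * ((2 * n) choose Suc n) = n * ((2 * n) choose n)" by simp
  then have "(2 * n) choose n = Suc n * ((2 * n choose n) - (2 * n choose Suc n))"
    by (simp only: diff_mult_distrib2) simp
  then show ?thesis by (metis dvd_triv_left)
qed

lemma real_catalan: "real (catalan n) = fact (2 * n) / (fact n * fact (Suc n))"
proof -
  have "real (catalan n) = real ((2 * n) choose n) / real (n + 1)"
    using Suc_dvd_central_binomial[of n] by (simp add: catalan_def real_of_nat_div)
  also have "real ((2 * n) choose n) = fact (2 * n) / (fact n * fact n)"
    by (simp add: binomial_fact)
  finally show ?thesis by (simp add: field_simps)
qed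

lemma real_catalan_Suc: "real (catalan (Suc n)) * (real n + 2) = real (catalan n) * (2 * (2 * real n + 1))"
proof -
  have "(fact (2 * Suc n) :: real) = (2 * real n + 2) * (2 * real n + 1) * fact (2 * n)"
    by (simp add: algebra_simps)
  then show ?thesis
    unfolding real_catalan by (simp add: divide_simps) (simp add: algebra_simps)
qed

lemma catalan_0 [simp]: "catalan 0 = 1"
  by (simp add: catalan_def)

text \<open>The generating function of the Catalan numbers is \<open>(1 - sqrt (1 - 4 x)) / (2 x)\<close>.\<close>

lemma catalan_conv_gbinomial: "real (catalan n) = - ((1/2) gchoose Suc n) * (-4) ^ Suc n / 2"
proof (induction n)
  case (Suc n)
  \<comment> \<open>The ratio of consecutive binomials of 1/2, multiplied by -4, agrees with the
    ratio in \<open>real_catalan_Suc\<close>.\<close>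
  have g: "((1/2 :: real) gchoose Suc (Suc n)) * (real n + 2) = (1/2 gchoose Suc n) * (1/2 - real (Suc n))"
    using gbinomial_mult_1[of "1/2 :: real" "Suc n"] by (simp add: algebra_simps)
  have "real (catalan (Suc n)) * (real n + 2)
      = (- ((1/2) gchoose Suc n) * (-4) ^ Suc n / 2) * (2 * (2 * real n + 1))"
    unfolding real_catalan_Suc Suc by simp
  also have "\<dots> = - (((1/2) gchoose Suc n) * (1/2 - real (Suc n))) * (-4) ^ Suc (Suc n) / 2"
    by (simp add: algebra_simps)
  also have "\<dots> = (- ((1/2) gchoose Suc (Suc n)) * (-4) ^ Suc (Suc n) / 2) * (real n + 2)"
    unfolding g[symmetric] by (simp add: field_simps)
  finally show ?case
    by (subst (asm) mult_right_cancel) (use of_nat_0_le_iff[of n, where ?'a = real] in linarith)+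
qed simp

text \<open>The square of sqrt (1 + x) is 1 + x, so by Vandermonde the convolution of the binomials
  of 1/2 vanishes in every degree from 2 on. The two extreme terms, of index 0 and
  \<open>n + 2\<close>, give the left-hand side up to powers of -4.\<close>

lemma catalan_Suc: "catalan (Suc n) = (\<Sum>i\<le>n. catalan i * catalan (n - i))"
proof -
  define b :: "nat \<Rightarrow> real" where "b k = (1/2) gchoose k" for k
  have "(\<Sum>k\<le>Suc (Suc n). b k * b (Suc (Suc n) - k)) = (1 :: real) gchoose Suc (Suc n)"
    using gbinomial_Vandermonde[of "1/2 :: real" "1/2" "Suc (Suc n)"] by (simp add: b_def atMost_atLeast0)
  also have "(1 :: real) gchoose Suc (Suc n) = 0"
    using binomial_gbinomial[of 1 "Suc (Suc n)", where ?'a = real] by (simp add: binomial_eq_0)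
  finally have "(\<Sum>k\<le>n. b (Suc k) * b (Suc (n - k))) = - 2 * b (Suc (Suc n))"
    by (subst (asm) sum.atMost_Suc_shift, subst (asm) sum.atMost_Suc) (simp add: b_def Suc_diff_le)
  moreover have "real (catalan i) * real (catalan (n - i)) = b (Suc i) * b (Suc (n - i)) * ((-4) ^ Suc (Suc n) / 4)"
    if "i \<le> n" for i
  proof -
    have "Suc (Suc n) = Suc i + Suc (n - i)" using that by simp
    then have "(-4 :: real) ^ Suc (Suc n) = (-4) ^ Suc i * (-4) ^ Suc (n - i)"
      by (metis power_add)
    then show ?thesis by (simp add: catalan_conv_gbinomial b_def)
  qed
  then have "(\<Sum>i\<le>n. real (catalan i) * real (catalan (n - i)))
      = (\<Sum>i\<le>n. b (Suc i) * b (Suc (n - i))) * ((-4) ^ Suc (Suc n) / 4)"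
    unfolding sum_distrib_right by (intro sum.cong) auto
  ultimately have "(\<Sum>i\<le>n. real (catalan i) * real (catalan (n - i))) = real (catalan (Suc n))"
    by (simp add: catalan_conv_gbinomial b_def)
  then have "real (catalan (Suc n)) = real (\<Sum>i\<le>n. catalan i * catalan (n - i))"
    by simp
  then show ?thesis by (simp only: of_nat_eq_iff)
qed

section \<open>Recursion for the number of preimages\<close>

text \<open>Factors of an increasing word are increasing, so \<open>fertility_snoc\<close> turns
  into the recursion \<open>catalan_Suc\<close>.\<close>

lemma fertility_increasing: "sorted_wrt (<) \<pi> \<Longrightarrow> fertility \<pi> = catalan (length \<pi>)"
proof (induction "length \<pi>" arbitrary: \<pi> rule: less_induct)
  case less
  show ?case
  proof (cases \<pi> rule: rev_cases)
    case Nil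
    then show ?thesis by (simp add: fertility_Nil)
  next
    case (snoc X m)
    have sorted: "sorted_wrt (<) X" and less_m: "\<And>x. x \<in> set X \<Longrightarrow> x < m"
      using less.prems by (auto simp: snoc sorted_wrt_append)
    have "distinct (X @ [m])" using less.prems snoc by (simp add: strict_sorted_iff)
    then have "fertility \<pi> = (\<Sum>i\<le>length X. fertility (take i X) * fertility (drop i X))"
      unfolding snoc by (rule fertility_snoc) (rule less_m)
    also have "\<dots> = (\<Sum>i\<le>length X. catalan i * catalan (length X - i))"
      using sorted snoc by (intro sum.cong refl arg_cong2[of _ _ _ _ "(*)"])
        (auto simp: less.hyps sorted_wrt_take sorted_wrt_drop)
    also have "\<dots> = catalan (length \<pi>)" by (simp add: snoc catalan_Suc)
    finally show ?thesis .
  qed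
qed

text \<open>The cut exactly between \<open>X\<close> and \<open>Y\<close> is counted in the second
  sum, hence the strict bound in the first.\<close>

lemma sum_splits_append:
  fixes h :: "'a list \<Rightarrow> 'a list \<Rightarrow> nat"
  shows "(\<Sum>i\<le>length (X @ Y). h (take i (X @ Y)) (drop i (X @ Y)))
    = (\<Sum>i<length X. h (take i X) (drop i X @ Y)) + (\<Sum>i\<le>length Y. h (X @ take i Y) (drop i Y))"
proof -
  let ?f = "\<lambda>i. h (take i (X @ Y)) (drop i (X @ Y))"
  have "{..length (X @ Y)} = {..<length X} \<union> {length X..length X + length Y}" by auto
  then have "sum ?f {..length (X @ Y)} = sum ?f {..<length X} + sum ?f {length X..length X + length Y}"
    by (simp only:) (rule sum.union_disjoint; auto)
  also have "sum ?f {length X..length X + length Y} = (\<Sum>i\<le>length Y. ?f (i + length X))"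
    using sum.shift_bounds_cl_nat_ivl[of ?f 0 "length X" "length Y"] by (simp add: atMost_atLeast0 add.commute)
  finally show ?thesis by simp
qed

text \<open>Induction on the length of \<open>T\<close>, whose last letter \<open>t\<close> is
  removed by \<open>fertility_snoc\<close>. Cuts before \<open>M\<close> and cuts behind
  \<open>B\<close> are treated by the induction hypothesis, and for fixed \<open>r\<close> their
  contributions recombine into the term of index \<open>r\<close>. The cut right behind
  \<open>M\<close> gives the term of the largest \<open>r\<close>; the other cuts inside
  \<open>B\<close> contribute nothing.\<close>

lemma fertility_decomposition:
  assumes "distinct (A @ M # B @ T)" "\<And>x. x \<in> set A \<union> set B \<Longrightarrow> x < M" "\<And>x. x \<in> set T \<Longrightarrow> M < x"
    and "sorted_wrt (<) T" "B \<noteq> []"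
  shows "fertility (A @ M # B @ T) =
    (\<Sum>r<length T. fertility (A @ M # drop (Suc r) T) * fertility (B @ take r T))"
  using assms
proof (induction "length T" arbitrary: A T rule: less_induct)
  case less
  note prems = less.prems
  let ?F = fertility
  show ?case
  proof (cases T rule: rev_cases)
    case Nil
    \<comment> \<open>Without letters above \<open>M\<close> the word does not end in its maximum,
      and the sum is empty.\<close>
    have "last B < M" using prems(2,5) by simp
    then have "?F (A @ M # B) = 0"
      using prems(1,5) Nil by (intro fertility_eq_0[of _ M]) auto
    then show ?thesis using Nil by simp
  next
    case (snoc T' t)
    have T': "\<And>x. x \<in> set T' \<Longrightarrow> M < x \<and> x < t" "M < t" "sorted_wrt (<) T'"
      using prems(3,4) snoc by (auto simp: sorted_wrt_append)
    have less_t: "x < t" if "x \<in> set A \<union> {M} \<union> set B \<union> set T'" for x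
      using that T'(1,2) prems(2) by force
    have IH: "?F (A' @ M # B @ T'') = (\<Sum>r<length T''. ?F (A' @ M # drop (Suc r) T'') * ?F (B @ take r T''))"
      if "set A' \<subseteq> set A" "distinct A'" "set T'' \<subseteq> set T'" "sorted_wrt (<) T''" "length T'' \<le> length T'" for A' T''
    proof (rule less.hyps)
      show "distinct (A' @ M # B @ T'')"
        using that prems(1) snoc by (auto simp: strict_sorted_iff)
    qed (use that prems snoc T' in auto)
    \<comment> \<open>Cuts before \<open>M\<close>, where \<open>Z\<close> is what stands between
      \<open>M\<close> and the last letter \<open>t\<close>.\<close>
    let ?S1 = "\<lambda>Z. \<Sum>i\<le>length A. ?F (take i A) * ?F (drop i A @ M # Z)"
    let ?S2 = "\<Sum>i\<le>length T'. \<Sum>r<i. ?F (A @ M # drop (Suc r) (take i T')) * ?F (B @ take r T') * ?F (drop i T')"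
    \<comment> \<open>Applied to two values of \<open>Z\<close>: to \<open>B @ T'\<close> at the
      start, and to \<open>drop (Suc r) T'\<close> when the sums are recombined.\<close>
    have split: "?F (A @ M # Z @ [t]) = ?S1 Z + (\<Sum>i\<le>length Z. ?F (A @ M # take i Z) * ?F (drop i Z))"
      if "distinct Z" "set Z \<subseteq> set B \<union> set T'" for Z
    proof -
      have "distinct ((A @ M # Z) @ [t])" using that prems(1) snoc by auto
      then have "?F ((A @ M # Z) @ [t]) = (\<Sum>i\<le>length (A @ M # Z). ?F (take i (A @ M # Z)) * ?F (drop i (A @ M # Z)))"
        by (rule fertility_snoc) (use that less_t in auto)
      also have "\<dots> = (\<Sum>i<length (A @ [M]). ?F (take i (A @ [M])) * ?F (drop i (A @ [M]) @ Z)) +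
          (\<Sum>i\<le>length Z. ?F (A @ M # take i Z) * ?F (drop i Z))"
        using sum_splits_append[of "\<lambda>x y. ?F x * ?F y" "A @ [M]" Z] by simp
      also have "(\<Sum>i<length (A @ [M]). ?F (take i (A @ [M])) * ?F (drop i (A @ [M]) @ Z)) = ?S1 Z"
        by (simp add: lessThan_Suc_atMost)
      finally show ?thesis by simp
    qed
    have "?F (A @ M # B @ T) = ?S1 (B @ T') + (\<Sum>i\<le>length (B @ T'). ?F (A @ M # take i (B @ T')) * ?F (drop i (B @ T')))"
      using split[of "B @ T'"] prems(1) snoc by auto
    also have "(\<Sum>i\<le>length (B @ T'). ?F (A @ M # take i (B @ T')) * ?F (drop i (B @ T'))) =
        (\<Sum>i<length B. ?F (A @ M # take i B) * ?F (drop i B @ T')) +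
        (\<Sum>i\<le>length T'. ?F (A @ M # B @ take i T') * ?F (drop i T'))"
      using sum_splits_append[of "\<lambda>x y. ?F (A @ M # x) * ?F y" B T'] by simp
    \<comment> \<open>For \<open>i \<noteq> 0\<close> the first factor ends in a letter of
      \<open>B\<close>, which is below \<open>M\<close>, so only the cut directly behind
      \<open>M\<close> survives.\<close>
    also have "(\<Sum>i<length B. ?F (A @ M # take i B) * ?F (drop i B @ T')) = ?F (A @ [M]) * ?F (B @ T')"
    proof -
      have "?F (A @ M # take i B) = 0" if "i < length B" "i \<noteq> 0" for i
      proof (rule fertility_eq_0[of _ M])
        have "take i B \<noteq> []" using that by auto
        then have "last (take i B) \<in> set B" using last_in_set in_set_takeD by metis
        then show "last (A @ M # take i B) < M" using \<open>take i B \<noteq> []\<close> prems(2) by auto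
      qed (use prems(1) in \<open>auto dest: in_set_takeD\<close>)
      then have "(\<Sum>i<length B. ?F (A @ M # take i B) * ?F (drop i B @ T')) =
          (\<Sum>i\<in>{0}. ?F (A @ M # take i B) * ?F (drop i B @ T'))"
        using prems(5) by (intro sum.mono_neutral_right) auto
      then show ?thesis by simp
    qed
    also have "?S1 (B @ T') = (\<Sum>r<length T'. ?S1 (drop (Suc r) T') * ?F (B @ take r T'))"
    proof -
      have "?S1 (B @ T') = (\<Sum>i\<le>length A. ?F (take i A) *
          (\<Sum>r<length T'. ?F (drop i A @ M # drop (Suc r) T') * ?F (B @ take r T')))"
        using T'(3) prems(1) by (intro sum.cong refl arg_cong2[of _ _ _ _ "(*)"] IH) (auto dest: in_set_dropD)
      also have "\<dots> = (\<Sum>r<length T'. \<Sum>i\<le>length A. ?F (take i A) *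
          (?F (drop i A @ M # drop (Suc r) T') * ?F (B @ take r T')))"
        unfolding sum_distrib_left by (rule sum.swap)
      finally show ?thesis by (simp add: sum_distrib_right mult.assoc)
    qed
    also have "(\<Sum>i\<le>length T'. ?F (A @ M # B @ take i T') * ?F (drop i T')) = ?S2"
    proof (intro sum.cong refl)
      fix i assume "i \<in> {..length T'}"
      then have "?F (A @ M # B @ take i T') =
          (\<Sum>r<i. ?F (A @ M # drop (Suc r) (take i T')) * ?F (B @ take r (take i T')))"
        using T'(3) prems(1) by (subst IH) (auto dest: in_set_takeD simp: sorted_wrt_take)
      then show "?F (A @ M # B @ take i T') * ?F (drop i T') =
          (\<Sum>r<i. ?F (A @ M # drop (Suc r) (take i T')) * ?F (B @ take r T') * ?F (drop i T'))"
        by (simp add: sum_distrib_right min_absorb1)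
    qed
    \<comment> \<open>Exchange of summation over \<open>r < i\<close>. The new index
      \<open>i - Suc r\<close> is the length of the prefix kept from
      \<open>drop (Suc r) T'\<close>.\<close>
    also have "?S2 = (\<Sum>r<length T'. (\<Sum>i\<le>length T' - Suc r.
        ?F (A @ M # take i (drop (Suc r) T')) * ?F (drop i (drop (Suc r) T'))) * ?F (B @ take r T'))"
      unfolding sum_distrib_right sum.Sigma[OF finite_atMost ballI[OF finite_lessThan], simplified]
        sum.Sigma[OF finite_lessThan ballI[OF finite_atMost], simplified]
      by (rule sum.reindex_bij_witness[of _ "\<lambda>(r, i). (i + Suc r, r)" "\<lambda>(i, r). (r, i - Suc r)"])
         (auto simp: take_drop)
    finally have "?F (A @ M # B @ T) = ?F (A @ [M]) * ?F (B @ T') +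
        (\<Sum>r<length T'. (?S1 (drop (Suc r) T') + (\<Sum>i\<le>length T' - Suc r.
        ?F (A @ M # take i (drop (Suc r) T')) * ?F (drop i (drop (Suc r) T')))) * ?F (B @ take r T'))"
      by (simp only: distrib_right sum.distrib)
    \<comment> \<open>For fixed \<open>r\<close> the inner sums run through all cuts of
      \<open>A @ M # drop (Suc r) T'\<close>, so \<open>split\<close> puts the letter
      \<open>t\<close> back.\<close>
    also have "\<dots> = ?F (A @ [M]) * ?F (B @ T') +
        (\<Sum>r<length T'. ?F (A @ M # drop (Suc r) T' @ [t]) * ?F (B @ take r T'))"
      using T'(3) by (subst split) (auto simp: strict_sorted_iff dest: in_set_dropD)
    finally show ?thesis by (simp add: snoc)
  qed
qed

section \<open>Hook configurations on subwords\<close>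

text \<open>
  A finite set \<open>P\<close> of positions stands for the subword of \<open>f\<close> at these positions. This way the hooks of
  a subword need no renumbering.
\<close>

definition descents_on :: "(nat \<Rightarrow> nat) \<Rightarrow> nat set \<Rightarrow> nat set" where
  "descents_on f P = {i \<in> P. \<exists>j\<in>P. i < j \<and> f j < f i \<and> {i<..<j} \<inter> P = {}}"

text \<open>Only the hooks that start at a descent are recorded here.\<close>

definition hook_configs :: "(nat \<Rightarrow> nat) \<Rightarrow> nat set \<Rightarrow> hook set set" where
  "hook_configs f P = {H. H \<subseteq> P \<times> P \<and> fst ` H = descents_on f P \<and> inj_on fst H \<and> inj_on snd H \<and>
     (\<forall>(i, j)\<in>H. i < j \<and> f i < f j) \<and>
     (\<forall>(i, j)\<in>H. \<forall>(i', j')\<in>H. f j < f j' \<longrightarrow> i < j' \<longrightarrow> i' < j \<longrightarrow> i' \<le> i \<and> j \<le> j')}"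

text \<open>The top part of a hook starts half a unit to the right of its southwest endpoint; for
  integer positions this is \<open>fst h < k\<close>.\<close>

definition above :: "(nat \<Rightarrow> nat) \<Rightarrow> hook set \<Rightarrow> nat \<Rightarrow> hook set" where
  "above f H k = {h \<in> H. fst h < k \<and> k \<le> snd h \<and> f k < f (snd h)}"

text \<open>
  The color classes of \<open>c\<^sub>0\<close> and of a hook \<open>h\<close>, without the northeast endpoints, which have the colors
  left out in \<open>\<Theta>\<close>.
\<close>

definition uncovered :: "(nat \<Rightarrow> nat) \<Rightarrow> nat set \<Rightarrow> hook set \<Rightarrow> nat set" where
  "uncovered f P H = {k \<in> P - snd ` H. above f H k = {}}"

definition covered_by :: "(nat \<Rightarrow> nat) \<Rightarrow> nat set \<Rightarrow> hook set \<Rightarrow> hook \<Rightarrow> nat set" where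
  "covered_by f P H h =
     {k \<in> P - snd ` H. h \<in> above f H k \<and> (\<forall>h'\<in>above f H k. f (snd h) \<le> f (snd h'))}"

text \<open>The factor of \<open>uncovered\<close> belongs to the color of index 0, the others to
  the remaining colors in \<open>\<Theta>\<close>.\<close>

definition weight :: "(nat \<Rightarrow> nat) \<Rightarrow> nat set \<Rightarrow> hook set \<Rightarrow> nat" where
  "weight f P H = catalan (card (uncovered f P H)) * (\<Prod>h\<in>H. catalan (card (covered_by f P H h)))"

lemma hook_configsI:
  assumes "H \<subseteq> P \<times> P" "fst ` H = descents_on f P" "inj_on fst H" "inj_on snd H"
    and "\<And>i j. (i, j) \<in> H \<Longrightarrow> i < j \<and> f i < f j"
    and "\<And>i j i' j'. \<lbrakk>(i, j) \<in> H; (i', j') \<in> H; f j < f j'; i < j'; i' < j\<rbrakk> \<Longrightarrow> i' \<le> i \<and> j \<le> j'"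
  shows "H \<in> hook_configs f P"
  unfolding hook_configs_def using assms by blast

lemma hook_configsD:
  assumes "H \<in> hook_configs f P"
  shows "H \<subseteq> P \<times> P" "fst ` H = descents_on f P" "inj_on fst H" "inj_on snd H"
    and "\<And>i j. (i, j) \<in> H \<Longrightarrow> i < j \<and> f i < f j"
    and "\<And>i j i' j'. \<lbrakk>(i, j) \<in> H; (i', j') \<in> H; f j < f j'; i < j'; i' < j\<rbrakk> \<Longrightarrow> i' \<le> i \<and> j \<le> j'"
  using assms unfolding hook_configs_def by blast+

lemma hook_configs_functional:
  assumes "H \<in> hook_configs f P"
  shows "(i, j) \<in> H \<Longrightarrow> (i, j') \<in> H \<Longrightarrow> j = j'" "(i, j) \<in> H \<Longrightarrow> (i', j) \<in> H \<Longrightarrow> i = i'"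
  using inj_onD[OF hook_configsD(3)[OF assms], of "(i, j)" "(i, j')"]
    inj_onD[OF hook_configsD(4)[OF assms], of "(i, j)" "(i', j)"] by simp_all

lemma finite_hook_configs: "finite P \<Longrightarrow> finite (hook_configs f P)"
  by (rule finite_subset[of _ "Pow (P \<times> P)"]) (auto simp: hook_configs_def)

lemma finite_hook_config: "finite P \<Longrightarrow> H \<in> hook_configs f P \<Longrightarrow> finite H"
  using finite_subset[OF hook_configsD(1)] by blast

text \<open>Take the last position \<open>z\<close> in front of \<open>y\<close> whose value is at
  least \<open>f x\<close>. The next position of \<open>P\<close> is either \<open>y\<close> or
  carries a value below \<open>f x\<close>, so \<open>z\<close> is a descent.\<close>

lemma descent_between:
  assumes "finite P" "x \<in> P" "y \<in> P" "x < y" "f y < f x"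
  shows "\<exists>z\<in>descents_on f P. x \<le> z \<and> z < y \<and> f x \<le> f z"
proof -
  define Z where "Z = {z \<in> P. x \<le> z \<and> z < y \<and> f x \<le> f z}"
  define z where "z = Max Z"
  have Z: "finite Z" "x \<in> Z" using assms by (auto simp: Z_def)
  then have z: "z \<in> Z" unfolding z_def by (intro Max_in) auto
  define W where "W = {v \<in> P. z < v}"
  have W: "finite W" "y \<in> W" using assms z by (auto simp: W_def Z_def)
  define v where "v = Min W"
  have v: "v \<in> W" "v \<le> y" using W Min_in[of W] by (auto simp: v_def simp del: Min_in)
  have gap: "{z<..<v} \<inter> P = {}"
  proof -
    have "v \<le> u" if "u \<in> P" "z < u" for u using that W by (auto simp: v_def W_def)
    then show ?thesis by force
  qed
  have "f v < f z"
  proof (cases "v = y")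
    case True
    then show ?thesis using assms z by (auto simp: Z_def)
  next
    case False
    have "z < v" using v(1) by (simp add: W_def)
    then have "v \<notin> Z" using Max_ge[OF Z(1), of v] unfolding z_def by linarith
    then show ?thesis using False \<open>z < v\<close> v z by (auto simp: Z_def W_def)
  qed
  then have "z \<in> descents_on f P" using gap v z by (auto simp: descents_on_def W_def Z_def)
  then show ?thesis using z by (auto simp: Z_def)
qed

section \<open>Cutting a subword at its highest descent top\<close>

locale highest_descent =
  fixes f :: "nat \<Rightarrow> nat" and P :: "nat set" and d :: nat
  assumes finite_P: "finite P" and inj: "inj_on f P"
    and descent: "d \<in> descents_on f P" and highest: "\<And>i. i \<in> descents_on f P \<Longrightarrow> f i \<le> f d"
begin

text \<open>If \<open>d\<close> is the position of \<open>M\<close> in the word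
  \<open>A M B T\<close>, these are the positions of \<open>T\<close>.\<close>

definition tail :: "nat set" where "tail = {x \<in> P. f d < f x}"

text \<open>The points that are not, respectively are, sheltered by the hook from \<open>d\<close> to \<open>j\<close>.\<close>

definition unsheltered :: "nat \<Rightarrow> nat set" where "unsheltered j = {x \<in> P. x \<le> d \<or> j < x}"

definition sheltered :: "nat \<Rightarrow> nat set" where "sheltered j = {x \<in> P. d < x \<and> x < j}"

lemma d_in_P: "d \<in> P"
  using descent by (simp add: descents_on_def)

text \<open>A higher point to the left would, by \<open>descent_between\<close>, produce a descent
  top above \<open>f d\<close>.\<close>

lemma before: "x \<in> P \<Longrightarrow> x < d \<Longrightarrow> f x < f d"
proof (rule ccontr)
  assume x: "x \<in> P" "x < d" "\<not> f x < f d"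
  moreover have "f x \<noteq> f d" using x inj d_in_P by (auto dest: inj_onD)
  ultimately obtain z where "z \<in> descents_on f P" "f x \<le> f z"
    using descent_between[of P x d f] finite_P d_in_P by force
  then show False using highest[of z] x \<open>f x \<noteq> f d\<close> by simp
qed

lemma tail_after: "x \<in> tail \<Longrightarrow> d < x"
  using before[of x] by (cases x d rule: linorder_cases) (auto simp: tail_def)

text \<open>A drop behind a point of the tail would produce a descent top above \<open>f d\<close>.
  Together with \<open>before\<close> and \<open>tail_upward\<close> this gives the shape
  \<open>A M B T\<close>.\<close>

lemma tail_increasing: "x \<in> tail \<Longrightarrow> y \<in> P \<Longrightarrow> x < y \<Longrightarrow> f x < f y"
proof (rule ccontr)
  assume *: "x \<in> tail" "y \<in> P" "x < y" "\<not> f x < f y"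
  then have "f x \<noteq> f y" using inj by (auto simp: tail_def dest: inj_onD)
  then obtain z where "z \<in> descents_on f P" "f x \<le> f z"
    using descent_between[of P x y f] finite_P * by (force simp: tail_def)
  then show False using highest[of z] * by (simp add: tail_def)
qed

lemma tail_upward: "x \<in> tail \<Longrightarrow> y \<in> P \<Longrightarrow> x < y \<Longrightarrow> y \<in> tail"
  using tail_increasing[of x y] by (auto simp: tail_def)

lemma sheltered_less: "j \<in> tail \<Longrightarrow> x \<in> sheltered j \<Longrightarrow> f x < f j"
proof -
  assume *: "j \<in> tail" "x \<in> sheltered j"
  show "f x < f j"
  proof (cases "x \<in> tail")
    case True
    then show ?thesis using tail_increasing[of x j] * by (auto simp: sheltered_def tail_def)
  next
    case False
    then show ?thesis using * by (auto simp: sheltered_def tail_def)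
  qed
qed

lemma descents_not_tail: "i \<in> descents_on f P \<Longrightarrow> i \<notin> tail"
  using highest[of i] by (auto simp: tail_def)

text \<open>Once the sheltered points are gone, \<open>d\<close> is followed by a point of the tail
  or by nothing, so it is no descent any more, and the tail contributes none. A descent before
  \<open>d\<close> keeps its successor, which is at most \<open>d\<close>.\<close>

lemma descents_unsheltered:
  assumes "j \<in> tail"
  shows "descents_on f (unsheltered j) = {i \<in> descents_on f P. i < d}"
proof (intro subset_antisym subsetI)
  fix i assume "i \<in> descents_on f (unsheltered j)"
  then obtain v where v: "i \<in> unsheltered j" "v \<in> unsheltered j" "i < v" "f v < f i"
    "{i<..<v} \<inter> unsheltered j = {}"
    by (auto simp: descents_on_def)
  have "i < d"
  proof (rule ccontr)
    assume "\<not> i < d"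
    then have "j < v" using v by (auto simp: unsheltered_def)
    then have "v \<in> tail" using tail_upward[OF assms] v by (auto simp: unsheltered_def)
    moreover from this have "i \<noteq> d" using v by (auto simp: tail_def)
    ultimately have "i \<in> tail" "v \<in> P"
      using v \<open>\<not> i < d\<close> tail_upward[OF assms] by (auto simp: unsheltered_def tail_def)
    then show False using tail_increasing[of i v] v by simp
  qed
  moreover have "v \<le> d"
  proof (rule ccontr)
    assume "\<not> v \<le> d"
    then have "d \<in> {i<..<v} \<inter> unsheltered j" using \<open>i < d\<close> d_in_P by (auto simp: unsheltered_def)
    then show False using v by blast
  qed
  then have "{i<..<v} \<inter> P = {}" using v(5) by (auto simp: unsheltered_def)
  ultimately show "i \<in> {i \<in> descents_on f P. i < d}"
    using v by (auto simp: descents_on_def unsheltered_def)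
next
  fix i assume "i \<in> {i \<in> descents_on f P. i < d}"
  then obtain v where v: "i \<in> P" "i < d" "v \<in> P" "i < v" "f v < f i" "{i<..<v} \<inter> P = {}"
    by (auto simp: descents_on_def)
  have "v \<le> d"
  proof (rule ccontr)
    assume "\<not> v \<le> d"
    then have "d \<in> {i<..<v} \<inter> P" using v(2) d_in_P by simp
    then show False using v(6) by simp
  qed
  then show "i \<in> descents_on f (unsheltered j)"
    using v by (auto simp: descents_on_def unsheltered_def intro!: bexI[of _ v])
qed

text \<open>The successor of a descent behind \<open>d\<close> is lower than \<open>f d\<close>,
  hence outside the tail and, as the tail is upward closed, to the left of \<open>j\<close>.\<close>

lemma descents_sheltered:
  assumes "j \<in> tail"
  shows "descents_on f (sheltered j) = {i \<in> descents_on f P. d < i}"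
proof (intro subset_antisym subsetI)
  fix i assume "i \<in> descents_on f (sheltered j)"
  then obtain v where v: "i \<in> sheltered j" "v \<in> sheltered j" "i < v" "f v < f i"
    "{i<..<v} \<inter> sheltered j = {}"
    by (auto simp: descents_on_def)
  then have "{i<..<v} \<inter> P = {}" by (auto simp: sheltered_def)
  then show "i \<in> {i \<in> descents_on f P. d < i}"
    using v by (auto simp: descents_on_def sheltered_def)
next
  fix i assume i: "i \<in> {i \<in> descents_on f P. d < i}"
  then obtain v where v: "i \<in> P" "d < i" "v \<in> P" "i < v" "f v < f i" "{i<..<v} \<inter> P = {}"
    by (auto simp: descents_on_def)
  have "v \<notin> tail" using descents_not_tail[of i] i v by (auto simp: tail_def)
  then have "v < j" using tail_upward[OF assms, of v] v assms by (cases v j rule: linorder_cases) auto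
  then show "i \<in> descents_on f (sheltered j)"
    using v by (auto simp: descents_on_def sheltered_def intro!: bexI[of _ v])
qed

section \<open>Restricting a configuration to the two parts\<close>

lemma hook_at_d:
  assumes "H \<in> hook_configs f P"
  obtains j where "j \<in> tail" "(d, j) \<in> H"
proof -
  have "d \<in> fst ` H" using hook_configsD(2)[OF assms] descent by simp
  then obtain j where "(d, j) \<in> H" by force
  moreover from this have "j \<in> tail" using hook_configsD(1,5)[OF assms] by (auto simp: tail_def)
  ultimately show ?thesis using that by blast
qed

text \<open>A hook from the left of \<open>d\<close> cannot end at \<open>j\<close>, where the hook
  from \<open>d\<close> ends. If it ended between \<open>d\<close> and \<open>j\<close>, it would be
  lower than that hook and cross it.\<close>

lemma restrict_unsheltered:
  assumes H: "H \<in> hook_configs f P" and j: "(d, j) \<in> H" "j \<in> tail"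
  shows "{h \<in> H. fst h < d} \<in> hook_configs f (unsheltered j)"
proof (rule hook_configsI)
  note D = hook_configsD[OF H]
  show "{h \<in> H. fst h < d} \<subseteq> unsheltered j \<times> unsheltered j"
  proof clarify
    fix i a assume h: "(i, a) \<in> H" "fst (i, a) < d"
    have "a \<le> d \<or> j < a"
    proof (rule ccontr)
      assume "\<not> (a \<le> d \<or> j < a)"
      then have "d < a" "a < j" using h j hook_configs_functional(2)[OF H, of d j i] by (auto simp: not_le not_less le_less)
      moreover have "f a < f j" using \<open>d < a\<close> \<open>a < j\<close> D(1) h j by (intro sheltered_less) (auto simp: sheltered_def)
      ultimately show False using D(6)[OF h(1) j(1)] h by simp
    qed
    then show "i \<in> unsheltered j \<and> a \<in> unsheltered j"
      using D(1) h by (auto simp: unsheltered_def)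
  qed
  show "fst ` {h \<in> H. fst h < d} = descents_on f (unsheltered j)"
    using D(2) descents_unsheltered[OF j(2)] by auto
  show "inj_on fst {h \<in> H. fst h < d}" "inj_on snd {h \<in> H. fst h < d}"
    using D(3,4) by (auto intro: inj_on_subset)
qed (use hook_configsD(5,6)[OF H] in auto)

text \<open>Such a hook starts left of \<open>j\<close> by \<open>descents_sheltered\<close>. If it
  ended to the right of \<open>j\<close>, it would be higher than the hook from \<open>d\<close> and
  overlap it without containing it.\<close>

lemma restrict_sheltered:
  assumes H: "H \<in> hook_configs f P" and j: "(d, j) \<in> H" "j \<in> tail"
  shows "{h \<in> H. d < fst h} \<in> hook_configs f (sheltered j)"
proof (rule hook_configsI)
  note D = hook_configsD[OF H]
  have fst: "fst ` {h \<in> H. d < fst h} = descents_on f (sheltered j)"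
    using D(2) descents_sheltered[OF j(2)] by auto
  then show "fst ` {h \<in> H. d < fst h} = descents_on f (sheltered j)" .
  show "{h \<in> H. d < fst h} \<subseteq> sheltered j \<times> sheltered j"
  proof clarify
    fix i a assume h: "(i, a) \<in> H" "d < fst (i, a)"
    then have "i \<in> descents_on f (sheltered j)" using fst by force
    then have i: "i \<in> sheltered j" by (simp add: descents_on_def)
    have "a < j"
    proof (rule ccontr)
      assume "\<not> a < j"
      then have "j < a" using h j hook_configs_functional(2)[OF H, of d j i] by (auto simp: not_less le_less)
      moreover have "f j < f a" using tail_increasing[OF j(2)] \<open>j < a\<close> D(1) h by blast
      ultimately show False using D(6)[OF j(1) h(1)] D(5)[OF h(1)] h i by (auto simp: sheltered_def)
    qed
    then show "i \<in> sheltered j \<and> a \<in> sheltered j"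
      using D(1) D(5)[OF h(1)] h i by (auto simp: sheltered_def)
  qed
  show "inj_on fst {h \<in> H. d < fst h}" "inj_on snd {h \<in> H. d < fst h}"
    using D(3,4) by (auto intro: inj_on_subset)
qed (use hook_configsD(5,6)[OF H] in auto)

section \<open>Gluing configurations of the two parts\<close>

context
  fixes j HU HS
  assumes j: "j \<in> tail" and HU: "HU \<in> hook_configs f (unsheltered j)" and HS: "HS \<in> hook_configs f (sheltered j)"
begin

private lemma j_facts: "j \<in> P" "d < j" "f d < f j"
  using j tail_after[OF j] by (auto simp: tail_def)

text \<open>A hook of the unsheltered part starts before \<open>d\<close>; since its end avoids the
  gap, it either stops by \<open>d\<close> or passes over the whole hook from \<open>d\<close> to
  \<open>j\<close>. This alternative decides how it meets the hooks outside
  \<open>HU\<close>.\<close>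

private lemma HU_facts:
  assumes "(i, a) \<in> HU"
  shows "i \<in> P" "a \<in> P" "i < d" "a \<le> d \<or> j < a \<and> f j < f a" "i < a" "f i < f a"
proof -
  have "i \<in> descents_on f (unsheltered j)" using hook_configsD(2)[OF HU] assms by force
  then show "i < d" "i \<in> P" using descents_unsheltered[OF j] by (auto simp: descents_on_def)
  have "a \<in> unsheltered j" using hook_configsD(1)[OF HU] assms by auto
  then show "a \<in> P" "a \<le> d \<or> j < a \<and> f j < f a" using tail_increasing[OF j] by (auto simp: unsheltered_def)
qed (use hook_configsD(5)[OF HU assms] in auto)

private lemma HS_facts:
  assumes "(i, a) \<in> HS"
  shows "i \<in> P" "a \<in> P" "d < i" "a < j" "i < a" "f i < f a" "f a < f j"
proof -
  have "i \<in> sheltered j" "a \<in> sheltered j" using hook_configsD(1)[OF HS] assms by auto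
  then show "i \<in> P" "a \<in> P" "d < i" "a < j" "f a < f j"
    using sheltered_less[OF j] by (auto simp: sheltered_def)
qed (use hook_configsD(5)[OF HS assms] in auto)

private lemma P_decompose:
  "P = insert j (unsheltered j \<union> sheltered j)" "j \<notin> unsheltered j" "j \<notin> sheltered j" "unsheltered j \<inter> sheltered j = {}"
  using j_facts by (auto simp: unsheltered_def sheltered_def)

private lemma snd_sub: "snd ` HU \<subseteq> unsheltered j" "snd ` HS \<subseteq> sheltered j"
  using hook_configsD(1)[OF HU] hook_configsD(1)[OF HS] by auto

lemma glue_hook_configs: "insert (d, j) (HU \<union> HS) \<in> hook_configs f P"
proof (rule hook_configsI)
  let ?H = "insert (d, j) (HU \<union> HS)"
  show "?H \<subseteq> P \<times> P" using HU_facts HS_facts j_facts d_in_P by auto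
  have fst_H: "fst ` ?H = insert d (descents_on f (unsheltered j) \<union> descents_on f (sheltered j))"
    by (simp add: image_Un hook_configsD(2)[OF HU] hook_configsD(2)[OF HS])
  have "i \<in> insert d (descents_on f (unsheltered j) \<union> descents_on f (sheltered j)) \<longleftrightarrow> i \<in> descents_on f P" for i
    unfolding descents_unsheltered[OF j] descents_sheltered[OF j]
    using descent by (cases i d rule: linorder_cases) auto
  then show "fst ` ?H = descents_on f P" unfolding fst_H by blast
  have "fst ` HU \<subseteq> {..<d}" "fst ` HS \<subseteq> {d<..}" using HU_facts(3) HS_facts(3) by force+
  then show "inj_on fst ?H"
    using hook_configsD(3)[OF HU] hook_configsD(3)[OF HS] unfolding inj_on_insert inj_on_Un by fastforce
  show "inj_on snd ?H"
    using hook_configsD(4)[OF HU] hook_configsD(4)[OF HS] snd_sub P_decompose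
    unfolding inj_on_insert inj_on_Un by (simp; blast)
  show "i < a \<and> f i < f a" if "(i, a) \<in> ?H" for i a
    using that HU_facts(5,6) HS_facts(5,6) j_facts by auto
  fix i a i' a' assume *: "(i, a) \<in> ?H" "(i', a') \<in> ?H" "f a < f a'" "i < a'" "i' < a"
  \<comment> \<open>Two hooks from different parts either do not overlap or are nested with the
    outer one higher.\<close>
  have nest1: "i' \<le> i \<and> a \<le> a'" if "(i, a) \<in> HU" "(i', a') \<in> HS"
    using HU_facts[OF that(1)] HS_facts[OF that(2)] * by auto
  have nest2: "i' \<le> i \<and> a \<le> a'" if "(i, a) \<in> HS" "(i', a') \<in> HU"
    using HS_facts[OF that(1)] HU_facts[OF that(2)] * by auto
  have nest3: "i' \<le> i \<and> a \<le> a'" if "(i, a) \<in> HU" "(i', a') = (d, j)"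
    using HU_facts[OF that(1)] that(2) * by auto
  have nest4: "i' \<le> i \<and> a \<le> a'" if "(i, a) = (d, j)" "(i', a') \<in> HU"
    using HU_facts[OF that(2)] that(1) * by auto
  have nest5: "i' \<le> i \<and> a \<le> a'" if "(i, a) \<in> HS" "(i', a') = (d, j)"
    using HS_facts[OF that(1)] that(2) * by auto
  have nest6: "i' \<le> i \<and> a \<le> a'" if "(i, a) = (d, j)" "(i', a') \<in> HS"
    using HS_facts[OF that(2)] that(1) * by auto
  have nest7: "i' \<le> i \<and> a \<le> a'" if "(i, a) = (d, j)" "(i', a') = (d, j)"
    using that * by simp
  show "i' \<le> i \<and> a \<le> a'"
    using *(1,2) hook_configsD(6)[OF HU _ _ *(3-5)] hook_configsD(6)[OF HS _ _ *(3-5)]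
      nest1 nest2 nest3 nest4 nest5 nest6 nest7 unfolding insert_iff Un_iff by argo
qed

lemma unglue_hook_configs:
  "{h \<in> insert (d, j) (HU \<union> HS). fst h < d} = HU" "{h \<in> insert (d, j) (HU \<union> HS). d < fst h} = HS"
  by (auto dest: HU_facts(3) HS_facts(3))

private lemma above_unsheltered:
  "k \<in> unsheltered j \<Longrightarrow> above f (insert (d, j) (HU \<union> HS)) k = above f HU k"
  by (auto simp: above_def unsheltered_def dest: HS_facts)

text \<open>The hook from \<open>d\<close> separates the heights: over a sheltered point, hooks of
  \<open>HS\<close> lie below it and hooks of \<open>HU\<close> above it. So a sheltered point can
  only be colored by \<open>HS\<close> or by the hook from \<open>d\<close>.\<close>

private lemma above_sheltered:
  assumes "k \<in> sheltered j"
  shows "above f HS k \<subseteq> above f (insert (d, j) (HU \<union> HS)) k" "(d, j) \<in> above f (insert (d, j) (HU \<union> HS)) k"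
    and "h \<in> above f (insert (d, j) (HU \<union> HS)) k \<Longrightarrow> h \<in> above f HS k \<and> f (snd h) < f j \<or> h = (d, j) \<or> h \<in> HU \<and> f j < f (snd h)"
proof -
  have k: "d < k" "k < j" "f k < f j" using assms sheltered_less[OF j] by (auto simp: sheltered_def)
  then show "above f HS k \<subseteq> above f (insert (d, j) (HU \<union> HS)) k" "(d, j) \<in> above f (insert (d, j) (HU \<union> HS)) k"
    by (auto simp: above_def)
  show "h \<in> above f (insert (d, j) (HU \<union> HS)) k \<Longrightarrow> h \<in> above f HS k \<and> f (snd h) < f j \<or> h = (d, j) \<or> h \<in> HU \<and> f j < f (snd h)"
    using k by (cases h) (auto simp: above_def dest: HU_facts(4) HS_facts(7))
qed

private lemma not_NE:
  "P - snd ` insert (d, j) (HU \<union> HS) = (unsheltered j - snd ` HU) \<union> (sheltered j - snd ` HS)"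
  using P_decompose snd_sub by auto

lemma uncovered_glue: "uncovered f P (insert (d, j) (HU \<union> HS)) = uncovered f (unsheltered j) HU"
proof (intro subset_antisym subsetI)
  fix k assume k: "k \<in> uncovered f P (insert (d, j) (HU \<union> HS))"
  then have "k \<notin> sheltered j" using above_sheltered(2)[of k] by (auto simp: uncovered_def)
  moreover have "k \<in> (unsheltered j - snd ` HU) \<union> (sheltered j - snd ` HS)"
    using k unfolding uncovered_def not_NE by simp
  ultimately have "k \<in> unsheltered j - snd ` HU" by simp
  then show "k \<in> uncovered f (unsheltered j) HU"
    using k above_unsheltered[of k] by (simp add: uncovered_def)
next
  fix k assume "k \<in> uncovered f (unsheltered j) HU"
  then show "k \<in> uncovered f P (insert (d, j) (HU \<union> HS))"
    using above_unsheltered[of k] unfolding uncovered_def not_NE by simp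
qed

text \<open>Sheltered points that no hook of \<open>HS\<close> covers see the hook from
  \<open>d\<close> first.\<close>

lemma covered_by_glue_d: "covered_by f P (insert (d, j) (HU \<union> HS)) (d, j) = uncovered f (sheltered j) HS"
proof (intro subset_antisym subsetI)
  fix k assume k: "k \<in> covered_by f P (insert (d, j) (HU \<union> HS)) (d, j)"
  then have *: "(d, j) \<in> above f (insert (d, j) (HU \<union> HS)) k" by (simp add: covered_by_def)
  have "k \<notin> unsheltered j" using * by (auto simp: above_def unsheltered_def)
  then have "k \<in> sheltered j - snd ` HS" using k unfolding covered_by_def not_NE by simp
  moreover have "h \<notin> above f HS k" for h
  proof
    assume h: "h \<in> above f HS k"
    then have "h \<in> above f (insert (d, j) (HU \<union> HS)) k"
      using above_sheltered(1)[of k] calculation by blast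
    then have "f j \<le> f (snd h)" using k unfolding covered_by_def by fastforce
    then show False using h HS_facts(7)[of "fst h" "snd h"] by (simp add: above_def)
  qed
  ultimately show "k \<in> uncovered f (sheltered j) HS" by (auto simp: uncovered_def)
next
  fix k assume "k \<in> uncovered f (sheltered j) HS"
  then have "k \<in> sheltered j - snd ` HS" "above f HS k = {}" by (auto simp: uncovered_def)
  moreover from this have "f j \<le> f (snd h')" if "h' \<in> above f (insert (d, j) (HU \<union> HS)) k" for h'
    using above_sheltered(3)[OF _ that] by auto
  ultimately show "k \<in> covered_by f P (insert (d, j) (HU \<union> HS)) (d, j)"
    unfolding covered_by_def not_NE using above_sheltered(2)[of k] by simp
qed

text \<open>A hook of \<open>HU\<close> over a sheltered point is higher than the hook from
  \<open>d\<close>, which is therefore hit before it.\<close>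

lemma covered_by_glue_unsheltered:
  assumes "h \<in> HU"
  shows "covered_by f P (insert (d, j) (HU \<union> HS)) h = covered_by f (unsheltered j) HU h"
proof (intro subset_antisym subsetI)
  fix k assume k: "k \<in> covered_by f P (insert (d, j) (HU \<union> HS)) h"
  then have *: "h \<in> above f (insert (d, j) (HU \<union> HS)) k"
    "\<And>h'. h' \<in> above f (insert (d, j) (HU \<union> HS)) k \<Longrightarrow> f (snd h) \<le> f (snd h')"
    by (simp_all add: covered_by_def)
  have "k \<notin> sheltered j"
  proof
    assume sh: "k \<in> sheltered j"
    have "f (snd h) \<le> f j" using *(2)[OF above_sheltered(2)[OF sh]] by simp
    moreover have "k \<le> snd h" "d < k" using *(1) sh by (simp_all add: above_def sheltered_def)
    ultimately show False using HU_facts(4)[of "fst h" "snd h"] assms by simp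
  qed
  then have "k \<in> unsheltered j - snd ` HU" using k unfolding covered_by_def not_NE by simp
  then show "k \<in> covered_by f (unsheltered j) HU h"
    using * above_unsheltered[of k] by (simp add: covered_by_def)
next
  fix k assume k: "k \<in> covered_by f (unsheltered j) HU h"
  then have "k \<in> unsheltered j - snd ` HU" by (simp add: covered_by_def)
  then show "k \<in> covered_by f P (insert (d, j) (HU \<union> HS)) h"
    using k above_unsheltered[of k] unfolding covered_by_def not_NE by simp
qed

text \<open>Over a sheltered point the hooks added by the gluing are all higher than those of
  \<open>HS\<close> and never win against them.\<close>

lemma covered_by_glue_sheltered:
  assumes "h \<in> HS"
  shows "covered_by f P (insert (d, j) (HU \<union> HS)) h = covered_by f (sheltered j) HS h"
proof (intro subset_antisym subsetI)
  fix k assume k: "k \<in> covered_by f P (insert (d, j) (HU \<union> HS)) h"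
  then have *: "h \<in> above f (insert (d, j) (HU \<union> HS)) k" by (simp add: covered_by_def)
  have "k \<notin> unsheltered j" using * assms HS_facts(3,4)[of "fst h" "snd h"] by (auto simp: above_def unsheltered_def)
  then have "k \<in> sheltered j - snd ` HS" using k unfolding covered_by_def not_NE by simp
  moreover have "h \<in> above f HS k" using * assms by (auto simp: above_def)
  ultimately show "k \<in> covered_by f (sheltered j) HS h"
    using k above_sheltered(1)[of k] by (auto simp: covered_by_def)
next
  fix k assume k: "k \<in> covered_by f (sheltered j) HS h"
  then have "k \<in> sheltered j - snd ` HS" "h \<in> above f HS k" by (auto simp: covered_by_def)
  moreover have "f (snd h) < f j" using assms HS_facts(7)[of "fst h" "snd h"] by simp
  moreover have "f (snd h) \<le> f (snd h')" if "h' \<in> above f (insert (d, j) (HU \<union> HS)) k" for h'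
    using above_sheltered(3)[OF _ that] calculation k by (auto simp: covered_by_def)
  ultimately show "k \<in> covered_by f P (insert (d, j) (HU \<union> HS)) h"
    using above_sheltered(1)[of k] unfolding covered_by_def not_NE by blast
qed

text \<open>The factor of \<open>uncovered\<close> for the sheltered part reappears as the factor of
  the new hook \<open>(d, j)\<close>; all other factors are carried over unchanged.\<close>

lemma weight_glue:
  "weight f P (insert (d, j) (HU \<union> HS)) = weight f (unsheltered j) HU * weight f (sheltered j) HS"
proof -
  let ?g = "\<lambda>h. catalan (card (covered_by f P (insert (d, j) (HU \<union> HS)) h))"
  have fin: "finite HU" "finite HS"
    using finite_hook_config[OF _ HU] finite_hook_config[OF _ HS] finite_P
    by (auto simp: unsheltered_def sheltered_def)
  have disj: "(d, j) \<notin> HU \<union> HS" "HU \<inter> HS = {}"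
    using HU_facts(3) HS_facts(3) by fastforce+
  have "prod ?g (insert (d, j) (HU \<union> HS)) = ?g (d, j) * (prod ?g HU * prod ?g HS)"
    using fin disj by (simp add: prod.union_disjoint)
  also have "prod ?g HU = (\<Prod>h\<in>HU. catalan (card (covered_by f (unsheltered j) HU h)))"
    by (intro prod.cong) (simp_all add: covered_by_glue_unsheltered)
  also have "prod ?g HS = (\<Prod>h\<in>HS. catalan (card (covered_by f (sheltered j) HS h)))"
    by (intro prod.cong) (simp_all add: covered_by_glue_sheltered)
  finally show ?thesis
    by (simp only: weight_def uncovered_glue covered_by_glue_d mult_ac)
qed

end

section \<open>The same recursion for weights and for fertilities\<close>

lemma sum_weight_decompose:
  "(\<Sum>H\<in>hook_configs f P. weight f P H) =
   (\<Sum>j\<in>tail. (\<Sum>H\<in>hook_configs f (unsheltered j). weight f (unsheltered j) H) *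
      (\<Sum>H\<in>hook_configs f (sheltered j). weight f (sheltered j) H))"
proof -
  \<comment> \<open>Classes by the northeast endpoint of the unique hook that starts at
    \<open>d\<close>. For fixed \<open>j\<close>, restricting and gluing are inverse to each other,
    and the weight is multiplicative.\<close>
  let ?C = "\<lambda>j. {H \<in> hook_configs f P. (d, j) \<in> H}"
  have "hook_configs f P = (\<Union>j\<in>tail. ?C j)" using hook_at_d by blast
  then have "sum (weight f P) (hook_configs f P) = sum (weight f P) (\<Union>j\<in>tail. ?C j)"
    by (rule arg_cong)
  also have "sum (weight f P) (\<Union>j\<in>tail. ?C j) = (\<Sum>j\<in>tail. sum (weight f P) (?C j))"
    using finite_P finite_hook_configs[OF finite_P, of f]
    by (intro sum.UNION_disjoint) (auto simp: tail_def dest: hook_configs_functional(1))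
  also have "\<dots> = (\<Sum>j\<in>tail. (\<Sum>H\<in>hook_configs f (unsheltered j). weight f (unsheltered j) H) *
      (\<Sum>H\<in>hook_configs f (sheltered j). weight f (sheltered j) H))"
  proof (rule sum.cong[OF refl])
    fix j assume j: "j \<in> tail"
    show "sum (weight f P) (?C j) = (\<Sum>H\<in>hook_configs f (unsheltered j). weight f (unsheltered j) H) *
      (\<Sum>H\<in>hook_configs f (sheltered j). weight f (sheltered j) H)"
      unfolding sum_product sum.cartesian_product
    proof (rule sum.reindex_bij_witness[of _ "\<lambda>(HU, HS). insert (d, j) (HU \<union> HS)"
          "\<lambda>H. ({h \<in> H. fst h < d}, {h \<in> H. d < fst h})"])
      fix H assume "H \<in> ?C j"
      then have H: "H \<in> hook_configs f P" "(d, j) \<in> H" by auto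
      have "h = (d, j)" if "h \<in> H" "fst h = d" for h
        using hook_configs_functional(1)[OF H(1,2), of "snd h"] that by (cases h) auto
      then have "fst h < d \<or> d < fst h \<or> h = (d, j)" if "h \<in> H" for h
        using that by (metis linorder_neqE_nat)
      then have glue: "insert (d, j) ({h \<in> H. fst h < d} \<union> {h \<in> H. d < fst h}) = H"
        using H(2) by blast
      then show "(case ({h \<in> H. fst h < d}, {h \<in> H. d < fst h}) of (HU, HS) \<Rightarrow> insert (d, j) (HU \<union> HS)) = H"
        by simp
      note R = restrict_unsheltered[OF H j] restrict_sheltered[OF H j]
      show "({h \<in> H. fst h < d}, {h \<in> H. d < fst h}) \<in> hook_configs f (unsheltered j) \<times> hook_configs f (sheltered j)"
        using R by simp
      show "(case ({h \<in> H. fst h < d}, {h \<in> H. d < fst h}) of (HU, HS) \<Rightarrow>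
          weight f (unsheltered j) HU * weight f (sheltered j) HS) = weight f P H"
        using weight_glue[OF j R] glue by simp
    next
      fix p assume "p \<in> hook_configs f (unsheltered j) \<times> hook_configs f (sheltered j)"
      then obtain HU HS where p: "p = (HU, HS)" and R: "HU \<in> hook_configs f (unsheltered j)" "HS \<in> hook_configs f (sheltered j)"
        by auto
      show "({h \<in> (case p of (HU, HS) \<Rightarrow> insert (d, j) (HU \<union> HS)). fst h < d},
          {h \<in> (case p of (HU, HS) \<Rightarrow> insert (d, j) (HU \<union> HS)). d < fst h}) = p"
        using unglue_hook_configs[OF j R] by (simp add: p)
      show "(case p of (HU, HS) \<Rightarrow> insert (d, j) (HU \<union> HS)) \<in> ?C j"
        using glue_hook_configs[OF j R] by (simp add: p)
    qed
  qed
  finally show ?thesis .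
qed

text \<open>This is \<open>fertility_decomposition\<close> in terms of positions: the summand of
  index \<open>r\<close> belongs to the hook from \<open>d\<close> to \<open>T ! r\<close>.\<close>

lemma fertility_decompose:
  "fertility (map f (sorted_list_of_set P)) =
   (\<Sum>j\<in>tail. fertility (map f (sorted_list_of_set (unsheltered j))) *
      fertility (map f (sorted_list_of_set (sheltered j))))"
proof -
  \<comment> \<open>A finite set of positions has only one strictly increasing enumeration, so each
    subword is identified by checking order and elements.\<close>
  have list: "sorted_list_of_set X = xs" if "sorted_wrt (<) xs" "set xs = X" for X :: "nat set" and xs
    using that sorted_list_of_set.idem_if_sorted_distinct[of xs] by (simp add: strict_sorted_iff)
  define A where "A = sorted_list_of_set {x \<in> P. x < d}"
  define B where "B = sorted_list_of_set {x \<in> P. d < x \<and> f x < f d}"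
  define T where "T = sorted_list_of_set tail"
  have fin: "finite tail" using finite_P by (simp add: tail_def)
  have sets: "set A = {x \<in> P. x < d}" "set B = {x \<in> P. d < x \<and> f x < f d}" "set T = tail"
    using finite_P fin by (auto simp: A_def B_def T_def)
  have sorted: "sorted_wrt (<) A" "sorted_wrt (<) B" "sorted_wrt (<) T"
    by (simp_all add: A_def B_def T_def)
  have B_less_T: "x < y" if "x \<in> set B" "y \<in> set T" for x y
    using tail_upward[of y x] that sets by (cases x y rule: linorder_cases) (auto simp: tail_def)
  have T_gt: "d < y" if "y \<in> set T" for y
    using that sets tail_after by auto
  have A_lt: "x < d" if "x \<in> set A" for x using that sets by simp
  have B_gt: "d < x" if "x \<in> set B" for x using that sets by simp
  have A_less: "x < y" if "x \<in> set A" "y \<in> set B \<union> set T" for x y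
    using A_lt[OF that(1)] that(2) B_gt[of y] T_gt[of y] by auto
  have P: "sorted_list_of_set P = A @ d # B @ T"
  proof (rule list)
    show "sorted_wrt (<) (A @ d # B @ T)"
      using sorted B_less_T T_gt A_lt B_gt A_less by (auto simp: sorted_wrt_append)
    have "f x < f d \<or> f d < f x" if "x \<in> P" "x \<noteq> d" for x
      using that inj_onD[OF inj, of x d] d_in_P by (metis linorder_neqE_nat)
    then show "set (A @ d # B @ T) = P"
      using sets d_in_P by (auto simp: tail_def)
  qed
  have inc: "sorted_wrt (<) (map f T)"
    unfolding sorted_wrt_map
    by (rule sorted_wrt_mono_rel[OF _ sorted(3)]) (use sets tail_increasing in \<open>auto simp: tail_def\<close>)
  have "fertility (map f (sorted_list_of_set P)) = fertility (map f A @ f d # map f B @ map f T)"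
    by (simp add: P)
  also have "\<dots> = (\<Sum>r<length (map f T). fertility (map f A @ f d # drop (Suc r) (map f T)) *
      fertility (map f B @ take r (map f T)))"
  proof (rule fertility_decomposition)
    have "distinct (map f (sorted_list_of_set P))"
      using inj finite_P by (simp add: distinct_map)
    then show "distinct (map f A @ f d # map f B @ map f T)" by (simp add: P)
    show "\<And>x. x \<in> set (map f A) \<union> set (map f B) \<Longrightarrow> x < f d" using sets before by auto
    show "\<And>x. x \<in> set (map f T) \<Longrightarrow> f d < x" using sets by (auto simp: tail_def)
    from descent obtain v where "v \<in> P" "d < v" "f v < f d" unfolding descents_on_def by blast
    then have "v \<in> set B" using sets(2) by simp
    then show "map f B \<noteq> []" by auto
  qed (rule inc)
  also have "\<dots> = (\<Sum>r<length T. fertility (map f (sorted_list_of_set (unsheltered (T ! r)))) *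
      fertility (map f (sorted_list_of_set (sheltered (T ! r)))))"
  proof (simp only: length_map, intro sum.cong refl)
    fix r assume "r \<in> {..<length T}"
    \<comment> \<open>With 0-based \<open>r\<close>, the position \<open>T ! r\<close> belongs to
      neither word: \<open>take r T\<close> is sheltered by the hook ending there, and
      \<open>drop (Suc r) T\<close> is not.\<close>
    then have split: "T = take r T @ T ! r # drop (Suc r) T" by (simp add: id_take_nth_drop)
    have sT: "sorted_wrt (<) (take r T @ T ! r # drop (Suc r) T)" using sorted(3) split by simp
    have setT: "set T = set (take r T) \<union> {T ! r} \<union> set (drop (Suc r) T)"
      by (subst split) (simp only: set_append set_simps Un_insert_right Un_empty_right Un_insert_left Un_empty_left)
    have lt: "x < T ! r" if "x \<in> set (take r T)" for x using sT that by (auto simp: sorted_wrt_append)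
    have gt: "T ! r < x" if "x \<in> set (drop (Suc r) T)" for x using sT that by (auto simp: sorted_wrt_append)
    have r: "T ! r \<in> tail" using setT sets by blast
    have "sorted_list_of_set (unsheltered (T ! r)) = A @ d # drop (Suc r) T"
    proof (rule list)
      show "sorted_wrt (<) (A @ d # drop (Suc r) T)"
        using sorted sT T_gt A_lt A_less setT by (auto simp: sorted_wrt_append)
      have "set (drop (Suc r) T) = {x \<in> P. T ! r < x}"
      proof (intro set_eqI iffI)
        fix x assume "x \<in> set (drop (Suc r) T)"
        moreover from this have "x \<in> tail" using setT sets(3) by blast
        ultimately show "x \<in> {x \<in> P. T ! r < x}" using gt[of x] by (simp add: tail_def)
      next
        fix x assume x: "x \<in> {x \<in> P. T ! r < x}"
        then have "x \<in> set T" using tail_upward[OF r] sets(3) by simp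
        then have "x \<in> set (take r T) \<or> x = T ! r \<or> x \<in> set (drop (Suc r) T)" using setT by blast
        then show "x \<in> set (drop (Suc r) T)" using lt[of x] x by auto
      qed
      then have "set (A @ d # drop (Suc r) T) = {x \<in> P. x < d} \<union> {d} \<union> {x \<in> P. T ! r < x}"
        by (simp add: sets(1))
      also have "\<dots> = unsheltered (T ! r)"
        unfolding unsheltered_def using d_in_P le_less[of _ d] by blast
      finally show "set (A @ d # drop (Suc r) T) = unsheltered (T ! r)" .
    qed
    moreover have "sorted_list_of_set (sheltered (T ! r)) = B @ take r T"
    proof (rule list)
      show "sorted_wrt (<) (B @ take r T)"
        using sorted sT B_less_T setT by (simp add: sorted_wrt_append)
      have takeT: "set (take r T) = {x \<in> tail. x < T ! r}"
      proof (intro set_eqI iffI)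
        fix x assume "x \<in> set (take r T)"
        then show "x \<in> {x \<in> tail. x < T ! r}" using lt[of x] setT sets(3) by blast
      next
        fix x assume x: "x \<in> {x \<in> tail. x < T ! r}"
        then have "x \<in> set (take r T) \<or> x = T ! r \<or> x \<in> set (drop (Suc r) T)" using setT sets(3) by blast
        then show "x \<in> set (take r T)" using gt[of x] x by auto
      qed
      have "f x < f d" if "x \<in> P" "x \<noteq> d" "x \<notin> tail" for x
        using that inj_onD[OF inj, of x d] d_in_P by (metis (mono_tags) linorder_neqE_nat mem_Collect_eq tail_def)
      then have below: "x \<in> set B \<union> set (take r T)" if "x \<in> sheltered (T ! r)" for x
        using that sets(2) takeT by (auto simp: sheltered_def)
      have "set B \<subseteq> sheltered (T ! r)"
        using sets(2) B_less_T[of _ "T ! r"] r sets(3) by (auto simp: sheltered_def)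
      moreover have "set (take r T) \<subseteq> sheltered (T ! r)"
        using takeT tail_after by (auto simp: sheltered_def tail_def)
      ultimately show "set (B @ take r T) = sheltered (T ! r)"
        using below by auto
    qed
    ultimately show "fertility (map f A @ f d # drop (Suc r) (map f T)) * fertility (map f B @ take r (map f T)) =
      fertility (map f (sorted_list_of_set (unsheltered (T ! r)))) *
      fertility (map f (sorted_list_of_set (sheltered (T ! r))))"
      by (simp add: drop_map take_map)
  qed
  also have "\<dots> = (\<Sum>j\<in>tail. fertility (map f (sorted_list_of_set (unsheltered j))) *
      fertility (map f (sorted_list_of_set (sheltered j))))"
    using bij_betw_nth[of T "{..<length T}" tail] sorted(3) sets(3)
    by (intro sum.reindex_bij_betw) (simp add: strict_sorted_iff)
  finally show ?thesis .
qed

end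

text \<open>Both sides obey the same recursion, and both parts omit \<open>j\<close>, so the
  induction runs over proper subsets of \<open>P\<close>. Without descents only the empty
  configuration exists, and both sides are the Catalan number of the length.\<close>

lemma fertility_eq_sum_weight:
  assumes "finite P" "inj_on f P"
  shows "fertility (map f (sorted_list_of_set P)) = (\<Sum>H\<in>hook_configs f P. weight f P H)"
  using assms
proof (induction P rule: finite_psubset_induct)
  case (psubset P)
  show ?case
  proof (cases "descents_on f P = {}")
    case True
    have "hook_configs f P = {{}}"
      using True by (auto intro!: hook_configsI dest: hook_configsD(2))
    moreover have "weight f P {} = catalan (card P)"
      by (simp add: weight_def uncovered_def above_def)
    moreover have "sorted_wrt (<) (map f (sorted_list_of_set P))"
      unfolding sorted_wrt_map
    proof (rule sorted_wrt_mono_rel[OF _ strict_sorted_list_of_set])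
      fix x y assume "x \<in> set (sorted_list_of_set P)" "y \<in> set (sorted_list_of_set P)" "x < y"
      then show "f x < f y"
        using descent_between[of P x y f] True psubset.hyps psubset.prems
        by (metis empty_iff inj_onD less_irrefl linorder_neqE_nat set_sorted_list_of_set)
    qed
    ultimately show ?thesis by (simp add: fertility_increasing)
  next
    case False
    have fin: "finite (descents_on f P)" using psubset.hyps by (simp add: descents_on_def)
    then have "Max (f ` descents_on f P) \<in> f ` descents_on f P" using False by (intro Max_in) auto
    then obtain d where d: "d \<in> descents_on f P" "f d = Max (f ` descents_on f P)" by force
    interpret highest_descent f P d
      using psubset d fin by unfold_locales auto
    have "unsheltered j \<subset> P" "sheltered j \<subset> P" if "j \<in> tail" for j
    proof -
      have "j \<in> P - unsheltered j" "j \<in> P - sheltered j" "unsheltered j \<subseteq> P" "sheltered j \<subseteq> P"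
        using that tail_after[OF that] by (auto simp: unsheltered_def sheltered_def tail_def)
      then show "unsheltered j \<subset> P" "sheltered j \<subset> P" by blast+
    qed
    then show ?thesis
      unfolding fertility_decompose sum_weight_decompose
      by (intro sum.cong refl arg_cong2[of _ _ _ _ "(*)"] psubset.IH inj_on_subset[OF psubset.prems])
        (simp_all add: psubset_imp_subset)
  qed
qed

section \<open>Passage to valid hook configurations\<close>

lemma descents_on_entry: "descents_on (entry \<pi>) {1..length \<pi>} = descents \<pi>"
proof (intro subset_antisym subsetI)
  fix i assume "i \<in> descents_on (entry \<pi>) {1..length \<pi>}"
  then obtain j where j: "1 \<le> i" "i < j" "j \<le> length \<pi>" "entry \<pi> j < entry \<pi> i"
    "{i<..<j} \<inter> {1..length \<pi>} = {}"
    unfolding descents_on_def by auto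
  have "j = Suc i"
  proof (rule ccontr)
    assume "j \<noteq> Suc i"
    then have "Suc i \<in> {i<..<j} \<inter> {1..length \<pi>}" using j(1-3) by simp
    then show False using j(5) by blast
  qed
  then show "i \<in> descents \<pi>" using j by (simp add: descents_def)
next
  fix i assume i: "i \<in> descents \<pi>"
  then have "{i<..<i + 1} \<inter> {1..length \<pi>} = {}" by auto
  then show "i \<in> descents_on (entry \<pi>) {1..length \<pi>}"
    using i unfolding descents_on_def descents_def by (auto intro!: bexI[of _ "i + 1"])
qed

lemma inj_on_entry: "distinct \<pi> \<Longrightarrow> inj_on (entry \<pi>) {1..length \<pi>}"
proof (rule inj_onI)
  fix i j assume "distinct \<pi>" "i \<in> {1..length \<pi>}" "j \<in> {1..length \<pi>}" "entry \<pi> i = entry \<pi> j"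
  moreover from this have "i - 1 < length \<pi>" "j - 1 < length \<pi>" "1 \<le> i" "1 \<le> j" by auto
  ultimately have "i - 1 = j - 1" "1 \<le> i" "1 \<le> j" using nth_eq_iff_index_eq[of \<pi>] by (simp_all add: entry_def)
  then show "i = j" by simp
qed

text \<open>The conditions of \<open>VHC02\<close> without hook indices: since southwest endpoints
  increase along the list, the list is recovered from its set of hooks. In (d) the real intervals
  are replaced by inequalities between integers.\<close>

definition hook_set02 :: "nat list \<Rightarrow> hook set \<Rightarrow> bool" where
  "hook_set02 \<pi> S \<longleftrightarrow> (\<forall>h\<in>S. is_hook \<pi> h) \<and> descents \<pi> \<subseteq> fst ` S \<and>
     (\<forall>(i, j)\<in>S. (j - 1, j) \<in> S \<and> (\<exists>i'\<in>descents \<pi>. (i', j) \<in> S)) \<and>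
     (\<forall>(i, j)\<in>S. \<forall>(i', j')\<in>S. entry \<pi> j < entry \<pi> j' \<longrightarrow> i < j' \<longrightarrow> i' < j \<longrightarrow> i' \<le> i \<and> j \<le> j') \<and>
     (\<forall>j\<in>{1..length \<pi>}. card {h \<in> S. snd h = j} \<in> {0, 2})"

lemma hook_set02D:
  assumes "hook_set02 \<pi> S"
  shows "\<And>i j. (i, j) \<in> S \<Longrightarrow> is_hook \<pi> (i, j)" "descents \<pi> \<subseteq> fst ` S"
    and "\<And>i j. (i, j) \<in> S \<Longrightarrow> (j - 1, j) \<in> S" "\<And>i j. (i, j) \<in> S \<Longrightarrow> \<exists>i'\<in>descents \<pi>. (i', j) \<in> S"
    and "\<And>i j i' j'. \<lbrakk>(i, j) \<in> S; (i', j') \<in> S; entry \<pi> j < entry \<pi> j'; i < j'; i' < j\<rbrakk> \<Longrightarrow> i' \<le> i \<and> j \<le> j'"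
    and "\<And>j. j \<in> {1..length \<pi>} \<Longrightarrow> card {h \<in> S. snd h = j} \<in> {0, 2}"
  using assms unfolding hook_set02_def by blast+

lemma hook_index_in_set: "l \<in> {1..length hs} \<Longrightarrow> (sw hs l, ne hs l) \<in> set hs"
  by (auto simp: sw_def ne_def intro!: nth_mem)

lemma set_hook_index: "h \<in> set hs \<Longrightarrow> \<exists>l\<in>{1..length hs}. h = (sw hs l, ne hs l)"
proof -
  assume "h \<in> set hs"
  then obtain r where "r < length hs" "hs ! r = h" by (auto simp: in_set_conv_nth)
  then show ?thesis by (intro bexI[of _ "Suc r"]) (auto simp: sw_def ne_def)
qed

lemma sw_increasing_iff:
  "(\<forall>l\<in>{1..length hs}. \<forall>l'\<in>{1..length hs}. l < l' \<longrightarrow> sw hs l < sw hs l') \<longleftrightarrow> sorted_wrt (<) (map fst hs)"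
  (is "?L \<longleftrightarrow> ?R")
proof
  assume L: ?L
  show ?R
    unfolding sorted_wrt_map unfolding sorted_wrt_iff_nth_less
  proof (intro allI impI)
    fix i j assume "i < j" "j < length hs"
    then show "fst (hs ! i) < fst (hs ! j)"
      using L[THEN bspec, of "Suc i", THEN bspec, of "Suc j"] by (simp add: sw_def)
  qed
next
  assume ?R
  then show ?L
    unfolding sorted_wrt_map unfolding sorted_wrt_iff_nth_less by (auto simp: sw_def)
qed

text \<open>The larger left end must be smaller than the smaller right end; these two ends are the
  witnesses.\<close>

lemma real_intervals_overlap_iff:
  "(\<exists>x y. x \<noteq> y \<and> {x, y} \<subseteq> {real i..real j} \<inter> {real i'..real j'}) \<longleftrightarrow> i < j \<and> i < j' \<and> i' < j \<and> i' < j'"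
proof
  assume "\<exists>x y. x \<noteq> y \<and> {x, y} \<subseteq> {real i..real j} \<inter> {real i'..real j'}"
  then obtain x y where "x \<noteq> y" "real i \<le> x" "x \<le> real j" "real i' \<le> x" "x \<le> real j'"
    "real i \<le> y" "y \<le> real j" "real i' \<le> y" "y \<le> real j'" by auto
  then have "real i < real j \<and> real i < real j' \<and> real i' < real j \<and> real i' < real j'"
    by linarith
  then show "i < j \<and> i < j' \<and> i' < j \<and> i' < j'" by simp
next
  assume "i < j \<and> i < j' \<and> i' < j \<and> i' < j'"
  then show "\<exists>x y. x \<noteq> y \<and> {x, y} \<subseteq> {real i..real j} \<inter> {real i'..real j'}"
    by (intro exI[of _ "real (max i i')"] exI[of _ "real (min j j')"]) auto
qed

lemma distinct_of_sorted_fst: "sorted_wrt (<) (map fst (hs :: hook list)) \<Longrightarrow> distinct hs"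
  by (simp add: strict_sorted_iff distinct_map)

lemma inj_on_hook_index: "distinct hs \<Longrightarrow> inj_on (\<lambda>l. hs ! (l - 1)) {1..length hs}"
proof (rule inj_onI)
  fix l l' assume "distinct hs" "l \<in> {1..length hs}" "l' \<in> {1..length hs}" "hs ! (l - 1) = hs ! (l' - 1)"
  moreover from this have "l - 1 < length hs" "l' - 1 < length hs" "1 \<le> l" "1 \<le> l'" by auto
  ultimately have "l - 1 = l' - 1" "1 \<le> l" "1 \<le> l'" using nth_eq_iff_index_eq[of hs] by simp_all
  then show "l = l'" by simp
qed

lemma w_eq_card: "distinct hs \<Longrightarrow> w hs j = card {h \<in> set hs. snd h = j}"
proof -
  assume "distinct hs"
  then have "inj_on (\<lambda>l. hs ! (l - 1)) {l \<in> {1..length hs}. ne hs l = j}"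
    by (rule inj_on_subset[OF inj_on_hook_index]) auto
  moreover have "(\<lambda>l. hs ! (l - 1)) ` {l \<in> {1..length hs}. ne hs l = j} = {h \<in> set hs. snd h = j}"
  proof (intro subset_antisym subsetI)
    fix h assume h: "h \<in> {h \<in> set hs. snd h = j}"
    then obtain l where l: "l \<in> {1..length hs}" "h = (sw hs l, ne hs l)"
      using set_hook_index[of h hs] by blast
    then have "h = hs ! (l - 1)" "ne hs l = j" using h by (simp_all add: sw_def ne_def)
    then show "h \<in> (\<lambda>l. hs ! (l - 1)) ` {l \<in> {1..length hs}. ne hs l = j}"
      using l(1) by blast
  next
    fix h assume "h \<in> (\<lambda>l. hs ! (l - 1)) ` {l \<in> {1..length hs}. ne hs l = j}"
    then obtain l where "l \<in> {1..length hs}" "ne hs l = j" "h = hs ! (l - 1)" by blast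
    moreover from this have "h = (sw hs l, ne hs l)" by (simp add: sw_def ne_def prod_eq_iff)
    ultimately have "l \<in> {1..length hs}" "ne hs l = j" "h = (sw hs l, ne hs l)" by blast+
    then show "h \<in> {h \<in> set hs. snd h = j}" using hook_index_in_set[of l hs] by simp
  qed
  ultimately show ?thesis
    unfolding w_def using card_image by fastforce
qed

text \<open>Condition (a) becomes the order of the list, and everything else depends only on the set
  of hooks.\<close>

lemma VHC02_iff: "hs \<in> VHC02 \<pi> \<longleftrightarrow> sorted_wrt (<) (map fst hs) \<and> hook_set02 \<pi> (set hs)"
proof
  assume "hs \<in> VHC02 \<pi>"
  then have valid: "valid_hook_config \<pi> hs" and w: "\<forall>j\<in>{1..length \<pi>}. w hs j \<in> {0, 2}"
    by (simp_all add: VHC02_def VHC_def)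
  note V = valid[unfolded valid_hook_config_def sw_increasing_iff real_intervals_overlap_iff]
  have sorted: "sorted_wrt (<) (map fst hs)" using V by blast
  have hooks: "\<forall>h\<in>set hs. is_hook \<pi> h" using V by blast
  have desc: "descents \<pi> \<subseteq> fst ` set hs"
  proof
    fix i assume "i \<in> descents \<pi>"
    then obtain l where "l \<in> {1..length hs}" "sw hs l = i" using V by blast
    then show "i \<in> fst ` set hs" using hook_index_in_set[of l hs] by force
  qed
  have pair: "(j - 1, j) \<in> set hs \<and> (\<exists>i'\<in>descents \<pi>. (i', j) \<in> set hs)" if ij: "(i, j) \<in> set hs" for i j
  proof -
    obtain l where l: "l \<in> {1..length hs}" "ne hs l = j" using set_hook_index[OF ij] by auto
    then obtain l' l'' where l': "l' \<in> {1..length hs}" "l'' \<in> {1..length hs}"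
      "sw hs l' \<in> descents \<pi>" "sw hs l'' = j - 1" "ne hs l' = j" "ne hs l'' = j"
      using V by blast
    then show ?thesis using hook_index_in_set[of l' hs] hook_index_in_set[of l'' hs] by auto
  qed
  have nest: "i' \<le> i \<and> j \<le> j'" if *: "(i, j) \<in> set hs" "(i', j') \<in> set hs"
    "entry \<pi> j < entry \<pi> j'" "i < j'" "i' < j" for i j i' j'
  proof -
    obtain l where l: "l \<in> {1..length hs}" "sw hs l = i" "ne hs l = j" using set_hook_index[OF *(1)] by auto
    obtain l' where l': "l' \<in> {1..length hs}" "sw hs l' = i'" "ne hs l' = j'" using set_hook_index[OF *(2)] by auto
    have "is_hook \<pi> (i, j)" "is_hook \<pi> (i', j')" using hooks *(1,2) by blast+
    then have "i < j" "i' < j'" by (simp_all add: is_hook_def)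
    \<comment> \<open>The repeated \<open>conjunct2\<close> picks condition (d), in which the
      overlap has already been turned into inequalities.\<close>
    moreover have "{real (sw hs l)..real (ne hs l)} \<subseteq> {real (sw hs l')..real (ne hs l')}"
      using V[THEN conjunct2, THEN conjunct2, THEN conjunct2, THEN conjunct2, rule_format, OF l(1) l'(1)]
        l l' *(3-5) calculation by simp
    ultimately have "{real i..real j} \<subseteq> {real i'..real j'}" unfolding l(2,3) l'(2,3) by blast
    then show ?thesis using \<open>i < j\<close> by simp
  qed
  have "\<forall>j\<in>{1..length \<pi>}. card {h \<in> set hs. snd h = j} \<in> {0, 2}"
    using w w_eq_card[OF distinct_of_sorted_fst[OF sorted]] by simp
  then show "sorted_wrt (<) (map fst hs) \<and> hook_set02 \<pi> (set hs)"
    unfolding hook_set02_def using sorted hooks desc pair nest by blast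
next
  assume "sorted_wrt (<) (map fst hs) \<and> hook_set02 \<pi> (set hs)"
  then have sorted: "sorted_wrt (<) (map fst hs)" and S: "hook_set02 \<pi> (set hs)" by auto
  note S' = S[unfolded hook_set02_def]
  have "\<exists>l\<in>{1..length hs}. sw hs l = i" if i: "i \<in> descents \<pi>" for i
  proof -
    have "i \<in> fst ` set hs" using hook_set02D(2)[OF S] i by blast
    then obtain h where h: "h \<in> set hs" "fst h = i" by blast
    then show ?thesis using set_hook_index[OF h(1)] by auto
  qed
  moreover have "\<exists>l'\<in>{1..length hs}. \<exists>l''\<in>{1..length hs}. sw hs l' \<in> descents \<pi> \<and>
      sw hs l'' = ne hs l - 1 \<and> ne hs l' = ne hs l \<and> ne hs l'' = ne hs l" if "l \<in> {1..length hs}" for l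
  proof -
    have "(sw hs l, ne hs l) \<in> set hs" using hook_index_in_set[OF that] .
    then obtain i' where i': "(ne hs l - 1, ne hs l) \<in> set hs" "i' \<in> descents \<pi>" "(i', ne hs l) \<in> set hs"
      using S' by blast
    then show ?thesis using set_hook_index[OF i'(1)] set_hook_index[OF i'(3)] by fastforce
  qed
  moreover have "{real (sw hs l)..real (ne hs l)} \<subseteq> {real (sw hs l')..real (ne hs l')}"
    if "l \<in> {1..length hs}" "l' \<in> {1..length hs}" "entry \<pi> (ne hs l) < entry \<pi> (ne hs l')"
      "sw hs l < ne hs l" "sw hs l < ne hs l'" "sw hs l' < ne hs l" "sw hs l' < ne hs l'" for l l'
  proof -
    have "sw hs l' \<le> sw hs l \<and> ne hs l \<le> ne hs l'"
      using S' hook_index_in_set[OF that(1)] hook_index_in_set[OF that(2)] that(3,5,6) by blast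
    then show ?thesis by auto
  qed
  ultimately have "valid_hook_config \<pi> hs"
    unfolding valid_hook_config_def sw_increasing_iff real_intervals_overlap_iff
    using sorted S' by blast
  then show "hs \<in> VHC02 \<pi>"
    using S' w_eq_card[OF distinct_of_sorted_fst[OF sorted]] by (simp add: VHC02_def VHC_def)
qed

section \<open>Descent hooks and their companions\<close>

definition descent_hooks :: "nat list \<Rightarrow> hook set \<Rightarrow> hook set" where
  "descent_hooks \<pi> S = {h \<in> S. fst h \<in> descents \<pi>}"

text \<open>The hooks from \<open>j - 1\<close> to \<open>j\<close> that condition (c) forces.\<close>

definition companions :: "hook set \<Rightarrow> hook set" where
  "companions H = (\<lambda>h. (snd h - 1, snd h)) ` H"

lemma not_descent_before_NE: "is_hook \<pi> (j - 1, j) \<Longrightarrow> j - 1 \<notin> descents \<pi>"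
  by (auto simp: is_hook_def descents_def)

text \<open>The hook from \<open>j - 1\<close> that (c) forces rises, so \<open>j - 1\<close> is no
  descent and the two known hooks are distinct. As at most two hooks may end at \<open>j\<close>,
  there are no others.\<close>

lemma hook_set02_two_hooks:
  assumes S: "hook_set02 \<pi> S" and ij: "(i, j) \<in> S" "i \<in> descents \<pi>"
  shows "{h \<in> S. snd h = j} = {(i, j), (j - 1, j)}"
proof -
  note D = hook_set02D[OF S]
  have "is_hook \<pi> (i, j)" using D(1) ij by blast
  then have "j \<in> {1..length \<pi>}" by (auto simp: is_hook_def)
  then have two: "card {h \<in> S. snd h = j} \<in> {0, 2}" by (rule D(6))
  have fin: "finite {h \<in> S. snd h = j}"
    by (rule finite_subset[of _ "{..j} \<times> {j}"]) (auto dest!: D(1) simp: is_hook_def)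
  have "i \<noteq> j - 1" using not_descent_before_NE[OF D(1)[OF D(3)[OF ij(1)]]] ij(2) by auto
  then have c: "card {(i, j), (j - 1, j)} = 2" by simp
  have sub: "{(i, j), (j - 1, j)} \<subseteq> {h \<in> S. snd h = j}" using ij D(3) by auto
  then have "card {h \<in> S. snd h = j} = 2" using two card_mono[OF fin sub] c by auto
  then show ?thesis using card_subset_eq[OF fin sub] c by simp
qed

text \<open>By (c) a descent hook ends wherever a hook ends, and \<open>hook_set02_two_hooks\<close>
  leaves only it and its companion. So the descent hooks determine the configuration.\<close>

lemma hook_set02_decompose:
  assumes S: "hook_set02 \<pi> S"
  shows "S = descent_hooks \<pi> S \<union> companions (descent_hooks \<pi> S)"
proof (intro subset_antisym subsetI)
  fix h assume h: "h \<in> S"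
  obtain i j where ij: "h = (i, j)" by (cases h)
  obtain i' where i': "i' \<in> descents \<pi>" "(i', j) \<in> S" using hook_set02D(4)[OF S] h ij by blast
  have "h \<in> {h \<in> S. snd h = j}" using h ij by simp
  then have "h = (i', j) \<or> h = (j - 1, j)" using hook_set02_two_hooks[OF S i'(2,1)] by blast
  then show "h \<in> descent_hooks \<pi> S \<union> companions (descent_hooks \<pi> S)"
    using i' by (force simp: descent_hooks_def companions_def)
next
  fix h assume "h \<in> descent_hooks \<pi> S \<union> companions (descent_hooks \<pi> S)"
  then show "h \<in> S" using hook_set02D(3)[OF S] by (auto simp: descent_hooks_def companions_def)
qed

text \<open>Of the two hooks with a common northeast endpoint one is the companion, whose start is
  no descent; hence \<open>snd\<close> is injective on the descent hooks.\<close>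

lemma descent_hooks_config:
  assumes S: "hook_set02 \<pi> S" and inj: "inj_on fst S"
  shows "descent_hooks \<pi> S \<in> hook_configs (entry \<pi>) {1..length \<pi>}"
proof (rule hook_configsI)
  note D = hook_set02D[OF S]
  show "descent_hooks \<pi> S \<subseteq> {1..length \<pi>} \<times> {1..length \<pi>}"
    using D(1) by (force simp: descent_hooks_def is_hook_def)
  show "fst ` descent_hooks \<pi> S = descents_on (entry \<pi>) {1..length \<pi>}"
    unfolding descents_on_entry using D(2) by (fastforce simp: descent_hooks_def)
  show "inj_on fst (descent_hooks \<pi> S)"
    using inj by (rule inj_on_subset) (auto simp: descent_hooks_def)
  show "inj_on snd (descent_hooks \<pi> S)"
  proof (rule inj_onI)
    fix h h' assume *: "h \<in> descent_hooks \<pi> S" "h' \<in> descent_hooks \<pi> S" "snd h = snd h'"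
    obtain i j where h: "h = (i, j)" by (cases h)
    have ij: "(i, j) \<in> S" "i \<in> descents \<pi>" and h': "h' \<in> S" "fst h' \<in> descents \<pi>"
      using * h by (auto simp: descent_hooks_def)
    have "h' \<in> {h \<in> S. snd h = j}" using h' * h by simp
    then have "h' = (i, j) \<or> h' = (j - 1, j)" unfolding hook_set02_two_hooks[OF S ij] by blast
    moreover have "j - 1 \<notin> descents \<pi>" using not_descent_before_NE D(1,3) ij(1) by blast
    ultimately show "h = h'" using h h'(2) by auto
  qed
  show "i < j \<and> entry \<pi> i < entry \<pi> j" if "(i, j) \<in> descent_hooks \<pi> S" for i j
    using D(1)[of i j] that by (simp add: descent_hooks_def is_hook_def)
qed (use hook_set02D(5)[OF S] in \<open>auto simp: descent_hooks_def\<close>)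

section \<open>Adding the companions to a set of descent hooks\<close>

context
  fixes \<pi> :: "nat list" and H :: "hook set"
  assumes dist: "distinct \<pi>" and H: "H \<in> hook_configs (entry \<pi>) {1..length \<pi>}"
begin

private lemma H_facts:
  assumes "(i, j) \<in> H"
  shows "1 \<le> i" "i < j" "j \<le> length \<pi>" "entry \<pi> i < entry \<pi> j" "i \<in> descents \<pi>"
  using hook_configsD(1,2)[OF H] hook_configsD(5)[OF H assms] assms descents_on_entry[of \<pi>] by force+

text \<open>If \<open>j - 1\<close> were a descent, its hook would end higher than \<open>j\<close>,
  and nesting would force \<open>i = j - 1\<close>, although the hook from \<open>i\<close> rises to
  \<open>j\<close>. So the companion is a hook and differs from \<open>(i, j)\<close>.\<close>

private lemma entry_before_NE:
  assumes ij: "(i, j) \<in> H"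
  shows "entry \<pi> (j - 1) < entry \<pi> j" "i < j - 1"
proof -
  note ijf = H_facts[OF ij]
  have not_desc: "j - 1 \<notin> descents \<pi>"
  proof
    assume d: "j - 1 \<in> descents \<pi>"
    then have "j - 1 \<in> fst ` H" using hook_configsD(2)[OF H] descents_on_entry[of \<pi>] by simp
    then obtain j' where j': "(j - 1, j') \<in> H" by force
    have less: "entry \<pi> j < entry \<pi> (j - 1)" using d ijf by (simp add: descents_def)
    also have "\<dots> < entry \<pi> j'" using H_facts(4)[OF j'] .
    finally have "j - 1 \<le> i"
      using hook_configsD(6)[OF H ij j'] ijf H_facts(2)[OF j'] by simp
    then have "i = j - 1" using ijf by simp
    then show False using less ijf by simp
  qed
  have "entry \<pi> (j - 1) \<noteq> entry \<pi> j"
    using inj_onD[OF inj_on_entry[OF dist], of "j - 1" j] ijf by fastforce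
  then show "entry \<pi> (j - 1) < entry \<pi> j" using not_desc ijf by (auto simp: descents_def)
  show "i < j - 1" using not_desc ijf by (cases "i = j - 1") auto
qed

text \<open>By the nesting condition, a hook that overlaps this one and ends higher must end at
  \<open>j\<close> or later.\<close>

private lemma entry_below_hook:
  assumes ij: "(i, j) \<in> H" and "(i', j') \<in> H" and "i < j'" "j' < j"
  shows "entry \<pi> j' < entry \<pi> j"
proof (rule ccontr)
  assume "\<not> entry \<pi> j' < entry \<pi> j"
  moreover have "entry \<pi> j' \<noteq> entry \<pi> j"
    using inj_onD[OF inj_on_entry[OF dist], of j' j] H_facts[OF ij] assms by fastforce
  ultimately have "entry \<pi> j < entry \<pi> j'" by simp
  then show False using hook_configsD(6)[OF H ij assms(2)] H_facts(2)[OF assms(2)] assms(3,4) by simp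
qed

private lemma mem_hooks: "(i, j) \<in> H \<union> companions H \<longleftrightarrow> (i, j) \<in> H \<or> i = j - 1 \<and> j \<in> snd ` H"
  by (force simp: companions_def)

text \<open>Companions start at nondescents, the hooks of \<open>H\<close> at descents. A companion
  is determined by its start, because \<open>1 \<le> j\<close> makes the truncated
  \<open>j - 1\<close> invertible.\<close>

lemma inj_on_fst_with_companions: "inj_on fst (H \<union> companions H)"
proof (rule inj_onI)
  fix h h' assume *: "h \<in> H \<union> companions H" "h' \<in> H \<union> companions H" "fst h = fst h'"
  obtain i j where h: "h = (i, j)" by (cases h)
  obtain j' where h': "h' = (i, j')" using * h by (cases h') auto
  have comp: "k - 1 \<notin> descents \<pi> \<and> 1 \<le> k" if k: "k \<in> snd ` H" for k
  proof -
    obtain l where "(l, k) \<in> H" using k by force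
    then show ?thesis using entry_before_NE[of l k] H_facts[of l k] by (auto simp: descents_def)
  qed
  have "(i, j) \<in> H \<or> i = j - 1 \<and> j \<in> snd ` H" "(i, j') \<in> H \<or> i = j' - 1 \<and> j' \<in> snd ` H"
    using * h h' mem_hooks by simp_all
  moreover from this have "j \<in> snd ` H" "j' \<in> snd ` H" by force+
  then have "j - 1 \<notin> descents \<pi>" "1 \<le> j" "j' - 1 \<notin> descents \<pi>" "1 \<le> j'" using comp by blast+
  ultimately have "j = j'"
    using H_facts(5)[of i j] H_facts(5)[of i j'] hook_configs_functional(1)[OF H, of i j j'] by fastforce
  then show "h = h'" using h h' by simp
qed

lemma descent_hooks_with_companions: "descent_hooks \<pi> (H \<union> companions H) = H"
proof -
  have "fst h \<notin> descents \<pi>" if h: "h \<in> companions H" for h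
  proof -
    obtain i j where "(i, j) \<in> H" "h = (j - 1, j)" using h unfolding companions_def by force
    then show ?thesis using entry_before_NE[of i j] H_facts[of i j] by (auto simp: descents_def)
  qed
  then show ?thesis using H_facts(5) by (fastforce simp: descent_hooks_def)
qed

lemma hook_set02_with_companions: "hook_set02 \<pi> (H \<union> companions H)"
  unfolding hook_set02_def
proof (intro conjI)
  let ?S = "H \<union> companions H"
  have NE: "\<exists>i0. (i0, j) \<in> H" if "(i, j) \<in> ?S" for i j
    using that mem_hooks by force
  show "\<forall>h\<in>?S. is_hook \<pi> h"
  proof clarify
    fix i j assume ij: "(i, j) \<in> ?S"
    then obtain i0 where "(i0, j) \<in> H" using NE by blast
    then show "is_hook \<pi> (i, j)"
      using H_facts[of i0 j] entry_before_NE[of i0 j] H_facts[of i j] ij mem_hooks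
      by (auto simp: is_hook_def)
  qed
  show "descents \<pi> \<subseteq> fst ` ?S"
    using hook_configsD(2)[OF H] descents_on_entry[of \<pi>] by auto
  show "\<forall>(i, j)\<in>?S. (j - 1, j) \<in> ?S \<and> (\<exists>i'\<in>descents \<pi>. (i', j) \<in> ?S)"
  proof clarify
    fix i j assume "(i, j) \<in> ?S"
    then obtain i0 where i0: "(i0, j) \<in> H" using NE by blast
    then have "(j - 1, j) \<in> ?S" using mem_hooks[of "j - 1" j] by force
    then show "(j - 1, j) \<in> ?S \<and> (\<exists>i'\<in>descents \<pi>. (i', j) \<in> ?S)"
      using i0 H_facts(5) by blast
  qed
  have nest: "i' \<le> i \<and> j \<le> j'"
    if *: "(i, j) \<in> ?S" "(i', j') \<in> ?S" "entry \<pi> j < entry \<pi> j'" "i < j'" "i' < j" for i j i' j'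
  proof -
    obtain i0 where i0: "(i0, j) \<in> H" using NE *(1) by blast
    obtain i0' where i0': "(i0', j') \<in> H" using NE *(2) by blast
    \<comment> \<open>The interval of a companion has length one, so an overlap puts it inside the
      other interval. If the companion is the lower hook, this is the claim; if it is the higher
      one, \<open>entry_below_hook\<close> refutes the assumed order of heights.\<close>
    consider (smaller_companion) "i = j - 1" "(i', j') \<in> H" | (both) "(i, j) \<in> H" "(i', j') \<in> H" | (larger_companion) "i' = j' - 1"
      using *(1,2) mem_hooks by blast
    then show ?thesis
    proof cases
      case smaller_companion
      then show ?thesis using *(4,5) by arith
    next
      case both
      then show ?thesis using hook_configsD(6)[OF H] * by blast
    next
      case larger_companion
      have "j \<noteq> j'" using *(3) by auto
      then have "j' < j" using larger_companion *(5) by simp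
      have "i0 < j'"
      proof (cases "(i, j) \<in> H")
        case True
        then show ?thesis using hook_configs_functional(2)[OF H i0] *(4) by blast
      next
        case False
        then have "i = j - 1" using *(1) mem_hooks by blast
        then show ?thesis using entry_before_NE(2)[OF i0] *(4) by simp
      qed
      then have "entry \<pi> j' < entry \<pi> j" using entry_below_hook[OF i0 i0'] \<open>j' < j\<close> by simp
      then show ?thesis using *(3) by simp
    qed
  qed
  then show "\<forall>(i, j)\<in>?S. \<forall>(i', j')\<in>?S. entry \<pi> j < entry \<pi> j' \<longrightarrow> i < j' \<longrightarrow> i' < j \<longrightarrow> i' \<le> i \<and> j \<le> j'"
    by blast
  show "\<forall>j\<in>{1..length \<pi>}. card {h \<in> ?S. snd h = j} \<in> {0, 2}"
  proof
    fix j
    show "card {h \<in> ?S. snd h = j} \<in> {0, 2}"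
    proof (cases "j \<in> snd ` H")
      case True
      then obtain i where ij: "(i, j) \<in> H" by force
      have "{h \<in> ?S. snd h = j} = {(i, j), (j - 1, j)}"
      proof (intro subset_antisym subsetI)
        fix h assume "h \<in> {h \<in> ?S. snd h = j}"
        moreover obtain k where "h = (k, snd h)" by (cases h) auto
        ultimately have "h = (k, j)" "(k, j) \<in> H \<or> k = j - 1" using mem_hooks[of k j] by auto
        then show "h \<in> {(i, j), (j - 1, j)}" using hook_configs_functional(2)[OF H ij, of k] by auto
      next
        fix h assume "h \<in> {(i, j), (j - 1, j)}"
        then show "h \<in> {h \<in> ?S. snd h = j}" using ij True mem_hooks[of "j - 1" j] by auto
      qed
      then show ?thesis using entry_before_NE(2)[OF ij] by simp
    next
      case False
      then have "{h \<in> ?S. snd h = j} = {}" by (force simp: companions_def)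
      then show ?thesis by (metis card.empty insertI1)
    qed
  qed
qed

end

lemma ex_sorted_hook_list:
  assumes "finite S" "inj_on fst (S :: hook set)"
  shows "\<exists>hs. sorted_wrt (<) (map fst hs) \<and> set hs = S"
proof (intro exI conjI)
  let ?hs = "map (inv_into S fst) (sorted_list_of_set (fst ` S))"
  have "map fst ?hs = sorted_list_of_set (fst ` S)"
    using assms(1) by (simp add: o_def) (intro map_idI, simp add: f_inv_into_f)
  then show "sorted_wrt (<) (map fst ?hs)" by (simp only: strict_sorted_list_of_set)
  show "set ?hs = S" using assms by (simp add: inv_into_f_f image_image)
qed

text \<open>Injectivity is \<open>hook_set02_decompose\<close>. The preimage of \<open>H\<close>
  lists the hooks of \<open>H\<close> and their companions by southwest endpoint.\<close>

lemma bij_betw_VHC02: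
  assumes "distinct \<pi>"
  shows "bij_betw (\<lambda>hs. descent_hooks \<pi> (set hs)) (VHC02 \<pi>) (hook_configs (entry \<pi>) {1..length \<pi>})"
proof (rule bij_betw_imageI)
  show "inj_on (\<lambda>hs. descent_hooks \<pi> (set hs)) (VHC02 \<pi>)"
  proof (rule inj_onI)
    fix hs hs' assume *: "hs \<in> VHC02 \<pi>" "hs' \<in> VHC02 \<pi>" "descent_hooks \<pi> (set hs) = descent_hooks \<pi> (set hs')"
    then have "set hs = set hs'"
      using hook_set02_decompose[of \<pi> "set hs"] hook_set02_decompose[of \<pi> "set hs'"] by (simp add: VHC02_iff)
    moreover have "sorted_wrt (<) (map fst hs)" "sorted_wrt (<) (map fst hs')" using * by (simp_all add: VHC02_iff)
    ultimately show "hs = hs'"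
      by (intro map_sorted_distinct_set_unique[of fst]) (auto simp: strict_sorted_iff distinct_map)
  qed
  show "(\<lambda>hs. descent_hooks \<pi> (set hs)) ` VHC02 \<pi> = hook_configs (entry \<pi>) {1..length \<pi>}"
  proof (intro subset_antisym subsetI)
    fix H assume "H \<in> (\<lambda>hs. descent_hooks \<pi> (set hs)) ` VHC02 \<pi>"
    then obtain hs where "H = descent_hooks \<pi> (set hs)" "hook_set02 \<pi> (set hs)" "inj_on fst (set hs)"
      by (auto simp: VHC02_iff strict_sorted_iff distinct_map)
    then show "H \<in> hook_configs (entry \<pi>) {1..length \<pi>}" using descent_hooks_config by simp
  next
    fix H assume H: "H \<in> hook_configs (entry \<pi>) {1..length \<pi>}"
    have "finite (H \<union> companions H)"
      using finite_hook_config[OF _ H] by (simp add: companions_def)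
    then obtain hs where hs: "sorted_wrt (<) (map fst hs)" "set hs = H \<union> companions H"
      using ex_sorted_hook_list inj_on_fst_with_companions[OF assms H] by blast
    then have "hs \<in> VHC02 \<pi>" using hook_set02_with_companions[OF assms H] by (simp add: VHC02_iff)
    moreover have "descent_hooks \<pi> (set hs) = H" using descent_hooks_with_companions[OF assms H] hs by simp
    ultimately show "H \<in> (\<lambda>hs. descent_hooks \<pi> (set hs)) ` VHC02 \<pi>" by blast
  qed
qed

section \<open>Colors, reduced color counts and weights\<close>

context
  fixes \<pi> :: "nat list" and hs :: "hook list" and H :: "hook set"
  assumes dist: "distinct \<pi>" and hs: "hs \<in> VHC02 \<pi>"
  defines "H \<equiv> descent_hooks \<pi> (set hs)"
begin

private lemma sorted_hs: "sorted_wrt (<) (map fst hs)" and S: "hook_set02 \<pi> (set hs)"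
  using hs by (simp_all add: VHC02_iff)

private lemma config: "H \<in> hook_configs (entry \<pi>) {1..length \<pi>}"
  using bij_betw_VHC02[OF dist] hs unfolding H_def by (auto simp: bij_betw_def)

private lemma set_hs: "set hs = H \<union> companions H"
  unfolding H_def using hook_set02_decompose[OF S] .

private lemma NE_eq: "NE hs = snd ` H"
proof -
  have "NE hs = snd ` set hs"
  proof (intro subset_antisym subsetI)
    fix j assume "j \<in> NE hs"
    then obtain l where "l \<in> {1..length hs}" "j = ne hs l" by (auto simp: NE_def)
    then show "j \<in> snd ` set hs" using hook_index_in_set[of l hs] by force
  next
    fix j assume "j \<in> snd ` set hs"
    then obtain h where "h \<in> set hs" "j = snd h" by blast
    then show "j \<in> NE hs" using set_hook_index[of h hs] by (auto simp: NE_def)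
  qed
  also have "\<dots> = snd ` H" unfolding set_hs by (force simp: companions_def)
  finally show ?thesis .
qed

private lemma index_unique:
  assumes "l \<in> {1..length hs}" "l' \<in> {1..length hs}" "sw hs l = sw hs l'"
  shows "l = l'"
  using assms sorted_hs unfolding sw_increasing_iff[symmetric]
  by (metis linorder_neqE_nat less_irrefl)

private lemma companion_not_descent:
  assumes "p \<in> NE hs"
  shows "(p - 1, p) \<in> set hs" "(p - 1, p) \<notin> H"
proof -
  show "(p - 1, p) \<in> set hs"
    using assms unfolding NE_eq set_hs companions_def by force
  then show "(p - 1, p) \<notin> H"
    using not_descent_before_NE[of \<pi> p] hook_set02D(1)[OF S] by (auto simp: H_def descent_hooks_def)
qed

text \<open>Among the hooks ending at \<open>p\<close> the companion has the rightmost possible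
  start \<open>p - 1\<close>, hence the largest index, and so it gives \<open>p\<close> its
  color.\<close>

private lemma color_NE:
  assumes p: "p \<in> NE hs"
  shows "color \<pi> hs p \<in> {1..length hs}" "sw hs (color \<pi> hs p) = p - 1" "ne hs (color \<pi> hs p) = p"
proof -
  define R where "R = {r \<in> {1..length hs}. ne hs r = p}"
  define m where "m = Max R"
  have color: "color \<pi> hs p = m" using p by (simp add: color_def R_def m_def)
  obtain l where l: "l \<in> {1..length hs}" "sw hs l = p - 1" "ne hs l = p"
    using set_hook_index[OF companion_not_descent(1)[OF p]] by auto
  have "finite R" "l \<in> R" using l by (auto simp: R_def)
  then have "m \<in> R" "l \<le> m" unfolding m_def by (auto intro: Max_in Max_ge)
  then have m: "m \<in> {1..length hs}" "ne hs m = p" by (simp_all add: R_def)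
  have "is_hook \<pi> (sw hs m, p)"
    using hook_set02D(1)[OF S] hook_index_in_set[OF m(1)] m(2) by simp
  then have "sw hs m \<le> p - 1" by (auto simp: is_hook_def)
  moreover have "sw hs l \<le> sw hs m"
  proof (cases "l = m")
    case False
    then show ?thesis
      using \<open>l \<le> m\<close> l(1) m(1) sorted_hs[folded sw_increasing_iff] by (simp add: less_imp_le)
  qed simp
  ultimately show "color \<pi> hs p \<in> {1..length hs}" "sw hs (color \<pi> hs p) = p - 1" "ne hs (color \<pi> hs p) = p"
    using m l(2) by (simp_all add: color)
qed

text \<open>The top part of the companion ending at \<open>p\<close> lies above no position but
  \<open>p\<close>, which is a northeast endpoint. So the remaining points only meet descent
  hooks.\<close>

private lemma hooks_above_iff:
  assumes "k \<notin> NE hs"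
  shows "l \<in> hooks_above \<pi> hs k \<longleftrightarrow> l \<in> {1..length hs} \<and> (sw hs l, ne hs l) \<in> above (entry \<pi>) H k"
proof -
  have half: "real i + 1/2 \<le> real k \<longleftrightarrow> i < k" for i
  proof -
    have "real i + 1/2 \<le> real k \<longleftrightarrow> real i < real k" by (cases "i < k") auto
    then show ?thesis by simp
  qed
  have "(sw hs l, ne hs l) \<in> H"
    if l: "l \<in> {1..length hs}" "sw hs l < k" "k \<le> ne hs l"
  proof (rule ccontr)
    assume "(sw hs l, ne hs l) \<notin> H"
    then have "(sw hs l, ne hs l) \<in> companions H"
      using hook_index_in_set[OF l(1)] unfolding set_hs by blast
    then have "sw hs l = ne hs l - 1" "ne hs l \<in> NE hs" unfolding NE_eq by (auto simp: companions_def)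
    then show False using l assms by (metis One_nat_def Suc_pred diff_is_0_eq le_antisym
          less_Suc_eq_le not_gr_zero not_less_eq_eq Suc_leI zero_le)
  qed
  then show ?thesis by (auto simp: hooks_above_def above_def half)
qed

text \<open>Ties never arise: hooks hit at the same height have the same northeast endpoint, and
  only one descent hook ends there. So \<open>ARG_MAX\<close> ranges over a single hook.\<close>

private lemma color_not_NE:
  assumes k: "k \<notin> NE hs"
  shows "color \<pi> hs k = 0 \<longleftrightarrow> above (entry \<pi>) H k = {}"
    and "l \<in> {1..length hs} \<Longrightarrow> color \<pi> hs k = l \<longleftrightarrow> l \<in> hooks_hit \<pi> hs k"
proof -
  have hit_range: "l \<in> {1..length hs}" if "l \<in> hooks_hit \<pi> hs k" for l
    using that by (auto simp: hooks_hit_def hooks_above_def)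
  have unique: "l = l'" if l: "l \<in> hooks_hit \<pi> hs k" and l': "l' \<in> hooks_hit \<pi> hs k" for l l'
  proof -
    have H: "(sw hs l, ne hs l) \<in> H" "(sw hs l', ne hs l') \<in> H"
      using l l' hooks_above_iff[OF k] by (auto simp: hooks_hit_def above_def)
    have "entry \<pi> (ne hs l) = entry \<pi> (ne hs l')"
      using l l' by (auto simp: hooks_hit_def intro: le_antisym)
    moreover have "ne hs l \<in> {1..length \<pi>}" "ne hs l' \<in> {1..length \<pi>}"
      using hook_configsD(1)[OF config] H by blast+
    ultimately have "ne hs l = ne hs l'" using inj_onD[OF inj_on_entry[OF dist]] by blast
    then have "sw hs l = sw hs l'" using hook_configs_functional(2)[OF config] H by metis
    then show "l = l'" using index_unique[OF hit_range[OF l] hit_range[OF l']] by blast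
  qed
  have color_hit: "color \<pi> hs k = l" if "l \<in> hooks_hit \<pi> hs k" for l
  proof -
    have "hooks_hit \<pi> hs k = {l}" using that unique by blast
    then show ?thesis using k by (auto simp: color_def arg_max_def is_arg_max_def)
  qed
  have color_no_hit: "color \<pi> hs k = 0" if "hooks_hit \<pi> hs k = {}"
    using k that by (simp add: color_def)
  have hit_empty: "hooks_hit \<pi> hs k = {} \<longleftrightarrow> hooks_above \<pi> hs k = {}"
  proof
    assume empty: "hooks_hit \<pi> hs k = {}"
    show "hooks_above \<pi> hs k = {}"
    proof (rule ccontr)
      assume ne: "hooks_above \<pi> hs k \<noteq> {}"
      have fin: "finite (hooks_above \<pi> hs k)" by (simp add: hooks_above_def)
      let ?l = "arg_min_on (\<lambda>l. entry \<pi> (ne hs l)) (hooks_above \<pi> hs k)"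
      have "?l \<in> hooks_above \<pi> hs k" by (rule arg_min_if_finite(1)[OF fin ne])
      moreover have "entry \<pi> (ne hs ?l) \<le> entry \<pi> (ne hs l)" if "l \<in> hooks_above \<pi> hs k" for l
        using arg_min_least[OF fin ne that, of "\<lambda>l. entry \<pi> (ne hs l)"] .
      ultimately have "?l \<in> hooks_hit \<pi> hs k" by (simp add: hooks_hit_def)
      then show False using empty by blast
    qed
  qed (auto simp: hooks_hit_def)
  have above_empty: "hooks_above \<pi> hs k = {} \<longleftrightarrow> above (entry \<pi>) H k = {}"
  proof
    assume empty: "hooks_above \<pi> hs k = {}"
    show "above (entry \<pi>) H k = {}"
    proof (rule ccontr)
      assume "above (entry \<pi>) H k \<noteq> {}"
      then obtain h where h: "h \<in> above (entry \<pi>) H k" by blast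
      then have "h \<in> set hs" unfolding set_hs by (simp add: above_def)
      then obtain l where "l \<in> {1..length hs}" "h = (sw hs l, ne hs l)" using set_hook_index by blast
      then have "l \<in> hooks_above \<pi> hs k" using hooks_above_iff[OF k] h by blast
      then show False using empty by blast
    qed
  next
    assume "above (entry \<pi>) H k = {}"
    then show "hooks_above \<pi> hs k = {}" using hooks_above_iff[OF k] by blast
  qed
  show "color \<pi> hs k = 0 \<longleftrightarrow> above (entry \<pi>) H k = {}"
  proof (cases "hooks_hit \<pi> hs k = {}")
    case True
    then show ?thesis using color_no_hit hit_empty above_empty by simp
  next
    case False
    then obtain l where l: "l \<in> hooks_hit \<pi> hs k" by blast
    then have "color \<pi> hs k \<noteq> 0" using color_hit hit_range by force
    then show ?thesis using False hit_empty above_empty by simp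
  qed
  show "color \<pi> hs k = l \<longleftrightarrow> l \<in> hooks_hit \<pi> hs k" if l: "l \<in> {1..length hs}"
  proof (cases "hooks_hit \<pi> hs k = {}")
    case True
    then show ?thesis using color_no_hit l by simp
  next
    case False
    then obtain l' where "l' \<in> hooks_hit \<pi> hs k" by blast
    then show ?thesis using color_hit[of l'] color_hit[of l] by blast
  qed
qed

private lemma q_0: "q \<pi> hs 0 = card (uncovered (entry \<pi>) {1..length \<pi>} H)"
proof -
  have "color \<pi> hs k = 0 \<longleftrightarrow> k \<notin> snd ` H \<and> above (entry \<pi>) H k = {}" for k
    using color_NE(1)[of k] color_not_NE(1)[of k] unfolding NE_eq by (cases "k \<in> snd ` H") auto
  then show ?thesis unfolding q_def uncovered_def by (intro arg_cong[of _ _ card]) auto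
qed

text \<open>Northeast endpoints carry the colors of companions, so the color class of a descent hook
  contains none of them.\<close>

private lemma q_descent_hook:
  assumes l: "l \<in> {1..length hs}" and h: "(sw hs l, ne hs l) \<in> H"
  shows "q \<pi> hs l = card (covered_by (entry \<pi>) {1..length \<pi>} H (sw hs l, ne hs l))"
proof -
  have "color \<pi> hs k = l \<longleftrightarrow> k \<notin> snd ` H \<and> (sw hs l, ne hs l) \<in> above (entry \<pi>) H k \<and>
      (\<forall>h'\<in>above (entry \<pi>) H k. entry \<pi> (ne hs l) \<le> entry \<pi> (snd h'))" for k
  proof (cases "k \<in> NE hs")
    case True
    have "color \<pi> hs k \<noteq> l"
    proof
      assume "color \<pi> hs k = l"
      then have "(k - 1, k) \<in> H" using color_NE(2,3)[OF True] h by simp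
      then show False using companion_not_descent(2)[OF True] by blast
    qed
    then show ?thesis using True NE_eq by simp
  next
    case False
    have "(\<forall>l'\<in>hooks_above \<pi> hs k. entry \<pi> (ne hs l) \<le> entry \<pi> (ne hs l')) \<longleftrightarrow>
        (\<forall>h'\<in>above (entry \<pi>) H k. entry \<pi> (ne hs l) \<le> entry \<pi> (snd h'))" (is "?L \<longleftrightarrow> ?R")
    proof
      assume L: ?L
      show ?R
      proof
        fix h' assume h': "h' \<in> above (entry \<pi>) H k"
        then have "h' \<in> set hs" unfolding set_hs by (simp add: above_def)
        then obtain l' where "l' \<in> {1..length hs}" "h' = (sw hs l', ne hs l')" using set_hook_index by blast
        then show "entry \<pi> (ne hs l) \<le> entry \<pi> (snd h')" using L hooks_above_iff[OF False] h' by auto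
      qed
    next
      assume ?R
      then show ?L using hooks_above_iff[OF False] by fastforce
    qed
    then show ?thesis
      using color_not_NE(2)[OF False l] hooks_above_iff[OF False, of l] l False NE_eq
      by (simp add: hooks_hit_def)
  qed
  then show ?thesis unfolding q_def covered_by_def by (intro arg_cong[of _ _ card]) auto
qed

text \<open>The colors of the northeast endpoints are exactly those of the companions, which leaves
  0 and the descent hooks.\<close>

private lemma \<Theta>_eq: "\<Theta> \<pi> hs = insert 0 {l \<in> {1..length hs}. (sw hs l, ne hs l) \<in> H}"
proof (intro subset_antisym subsetI)
  fix l assume l: "l \<in> \<Theta> \<pi> hs"
  show "l \<in> insert 0 {l \<in> {1..length hs}. (sw hs l, ne hs l) \<in> H}"
  proof (cases "l = 0")
    case False
    then have range: "l \<in> {1..length hs}" using l by (auto simp: \<Theta>_def)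
    have "(sw hs l, ne hs l) \<in> H"
    proof (rule ccontr)
      assume "(sw hs l, ne hs l) \<notin> H"
      then have "(sw hs l, ne hs l) \<in> companions H"
        using hook_index_in_set[OF range] unfolding set_hs by blast
      then have *: "sw hs l = ne hs l - 1" "ne hs l \<in> NE hs" unfolding NE_eq by (auto simp: companions_def)
      have "sw hs (color \<pi> hs (ne hs l)) = sw hs l" using color_NE(2)[OF *(2)] *(1) by (simp only:)
      then have "color \<pi> hs (ne hs l) = l" using index_unique[OF color_NE(1)[OF *(2)] range] by blast
      then show False using l *(2) unfolding \<Theta>_def by blast
    qed
    then show ?thesis using range by simp
  qed simp
next
  fix l assume l: "l \<in> insert 0 {l \<in> {1..length hs}. (sw hs l, ne hs l) \<in> H}"
  have "color \<pi> hs p \<noteq> l" if p: "p \<in> NE hs" for p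
  proof
    assume "color \<pi> hs p = l"
    then have "(p - 1, p) \<in> H" using color_NE[OF p] l by auto
    then show False using companion_not_descent(2)[OF p] by blast
  qed
  then show "l \<in> \<Theta> \<pi> hs" using l by (auto simp: \<Theta>_def)
qed

text \<open>\<open>\<Theta>\<close> has one element for the color 0 and one for each descent, so the
  product over \<open>t\<close> runs once through \<open>\<Theta>\<close>, and each of its factors
  is one of those in \<open>weight\<close>.\<close>

lemma prod_catalan_q_hat:
  "(\<Prod>t=0..card (descents \<pi>). catalan (q_hat \<pi> hs t)) = weight (entry \<pi>) {1..length \<pi>} H"
proof -
  let ?L = "{l \<in> {1..length hs}. (sw hs l, ne hs l) \<in> H}"
  have bij: "bij_betw (\<lambda>l. (sw hs l, ne hs l)) ?L H"
  proof (rule bij_betw_imageI)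
    show "inj_on (\<lambda>l. (sw hs l, ne hs l)) ?L" using index_unique by (auto intro!: inj_onI)
    show "(\<lambda>l. (sw hs l, ne hs l)) ` ?L = H"
    proof (intro subset_antisym subsetI)
      fix h assume h: "h \<in> H"
      then have "h \<in> set hs" unfolding set_hs by blast
      then obtain l where "l \<in> {1..length hs}" "h = (sw hs l, ne hs l)" using set_hook_index by blast
      then show "h \<in> (\<lambda>l. (sw hs l, ne hs l)) ` ?L" using h by blast
    qed blast
  qed
  have "card ?L = card H" using bij by (rule bij_betw_same_card)
  also have "\<dots> = card (fst ` H)" using card_image[OF hook_configsD(3)[OF config]] by simp
  also have "\<dots> = card (descents \<pi>)" using hook_configsD(2)[OF config] descents_on_entry by simp
  finally have card: "card (\<Theta> \<pi> hs) = Suc (card (descents \<pi>))" unfolding \<Theta>_eq by simp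
  have fin: "finite (\<Theta> \<pi> hs)" by (simp add: \<Theta>_def)
  let ?xs = "sorted_list_of_set (\<Theta> \<pi> hs)"
  have "bij_betw ((!) ?xs) {..<length ?xs} (\<Theta> \<pi> hs)"
    using fin by (intro bij_betw_nth) simp_all
  then have "bij_betw ((!) ?xs) {0..card (descents \<pi>)} (\<Theta> \<pi> hs)"
    by (simp add: card lessThan_Suc_atMost atMost_atLeast0)
  then have "(\<Prod>t=0..card (descents \<pi>). catalan (q_hat \<pi> hs t)) = (\<Prod>l\<in>\<Theta> \<pi> hs. catalan (q \<pi> hs l))"
    unfolding q_hat_def by (rule prod.reindex_bij_betw)
  also have "\<dots> = catalan (q \<pi> hs 0) * (\<Prod>l\<in>?L. catalan (q \<pi> hs l))"
    unfolding \<Theta>_eq by (subst prod.insert) auto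
  also have "(\<Prod>l\<in>?L. catalan (q \<pi> hs l)) =
      (\<Prod>l\<in>?L. catalan (card (covered_by (entry \<pi>) {1..length \<pi>} H (sw hs l, ne hs l))))"
    by (intro prod.cong refl) (simp add: q_descent_hook)
  also have "\<dots> = (\<Prod>h\<in>H. catalan (card (covered_by (entry \<pi>) {1..length \<pi>} H h)))"
    using bij by (rule prod.reindex_bij_betw)
  finally show ?thesis by (simp add: weight_def q_0)
qed

end

theorem theorem5p1:
  fixes n k :: nat and \<pi> :: "nat list"
  assumes "n \<ge> 1"
    and "\<pi> \<in> permutations_of_set {1..n}"
    and "card (descents \<pi>) = k"
  shows "card {\<sigma> \<in> permutations_of_set {1..n}. stack_sort \<sigma> = \<pi>} =
         (\<Sum>hs\<in>VHC02 \<pi>. \<Prod>t=0..k. catalan (q_hat \<pi> hs t))"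
proof -
  have dist: "distinct \<pi>" and set: "set \<pi> = {1..n}"
    using assms(2) by (auto simp: permutations_of_set_def)
  then have len: "length \<pi> = n" using distinct_card[of \<pi>] by simp
  have word: "map (entry \<pi>) (sorted_list_of_set {1..length \<pi>}) = \<pi>"
    by (rule nth_equalityI) (simp_all add: entry_def atLeastLessThanSuc_atLeastAtMost[symmetric] del: upt_Suc)
  \<comment> \<open>Stack-sorting preserves the multiset of letters, so every preimage of
    \<open>\<pi>\<close> is a permutation of \<open>{1..n}\<close>.\<close>
  have "{\<sigma> \<in> permutations_of_set {1..n}. stack_sort \<sigma> = \<pi>} = preimages \<pi>"
    using dist set mset_preimages[of _ \<pi>]
    by (auto simp: permutations_of_set_def preimages_def dest: mset_eq_setD mset_eq_imp_distinct_iff)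
  then have "card {\<sigma> \<in> permutations_of_set {1..n}. stack_sort \<sigma> = \<pi>} = fertility \<pi>"
    by (simp add: fertility_def)
  also have "\<dots> = (\<Sum>H\<in>hook_configs (entry \<pi>) {1..length \<pi>}. weight (entry \<pi>) {1..length \<pi>} H)"
    using fertility_eq_sum_weight[OF _ inj_on_entry[OF dist]] word by simp
  also have "\<dots> = (\<Sum>hs\<in>VHC02 \<pi>. weight (entry \<pi>) {1..length \<pi>} (descent_hooks \<pi> (set hs)))"
    by (rule sum.reindex_bij_betw[OF bij_betw_VHC02[OF dist], symmetric])
  also have "\<dots> = (\<Sum>hs\<in>VHC02 \<pi>. \<Prod>t=0..k. catalan (q_hat \<pi> hs t))"
    using prod_catalan_q_hat[OF dist] assms(3) by (intro sum.cong refl) simp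
  finally show ?thesis .
qed

end
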